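(* Let $(X,Y)$ be jointly distributed random variables on finite sets and let $(A,B)$ be random variables jointly distributed with $(X,Y)$. Then \[\mathcal{I}(X;Y\to A;B) \subseteq \big(H(B|Y)-H(A,B|X,Y),\; H(A|X)-H(A,B|X,Y)\big) + \mathcal{O}(X;Y\to A;B).\] In particular, if $H(A|X) \ge H(A,B|X,Y)$ and $H(B|Y)\ge H(A,B|X,Y)$, then $\mathcal{I}(X;Y\to A;B) \subseteq \mathcal{O}(X;Y\to A;B)$.
   Context: Protocols: a (randomized, private-coin) 2-party protocol $\Pi(X;Y)$ gives input $X$ to party 1 and $Y$ to party 2; the parties alternately send binary-string messages, each message a randomized function of the sender's current view (its input, its private randomness and the messages so far), and each party eventually produces an output. We write $\Pi(X;Y)\mapsto(A;B)$ if, when run on inputs distributed as $(X,Y)$, the outputs of party 1 and party 2 are jointly distributed with $(X,Y)$ exactly as $(A,B)$ is. The transcript $M$ is the concatenation of all messages. The information costs are $\mathrm{IC}_{12}(\Pi)=I(X;M|Y)$ and $\mathrm{IC}_{21}(\Pi)=I(Y;M|X)$. The information complexity region is $\mathcal{I}(X;Y\to A;B)=\{(r_1,r_2)\in\mathbb{R}_+^2: \exists \Pi \text{ with } \Pi(X;Y)\mapsto(A;B),\ I(X;M|Y)\le r_1,\ I(Y;M|X)\le r_2\}$. For jointly distributed $(U,V)$ and $c\ge 0$, define $\mathfrak{T}_c(U;V)=\{(r_1,r_2)\in\mathbb{R}_+^2: \exists\, p_{Q|UV} \text{ with } I(V;Q|U)\le r_1,\ I(U;Q|V)\le r_2,\ I(U;V|Q)\le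 c\}$. For $(a,b)\in\mathbb{R}^2$ and $S\subseteq\mathbb{R}^2$, $(a,b)+S=\{(x+a,y+b):(x,y)\in S\}$, and for $S_1,S_2\subseteq\mathbb{R}^2$, $S_1-S_2=\{(a,b)\in\mathbb{R}_+^2:(a,b)+S_2\subseteq S_1\}$. Finally $\mathcal{O}(X;Y\to A;B)=\bigcap_{c\ge 0}\big(\mathfrak{T}_c(B,Y;A,X)-\mathfrak{T}_c(Y;X)\big)$, where $\mathfrak{T}_c(B,Y;A,X)$ means $\mathfrak{T}_c(U;V)$ with $U=(B,Y)$, $V=(A,X)$. *)

theory Defs
  imports "HOL-Probability.Probability" "HOL-Library.Set_Algebras"
begin

section \<open>Information measures of discrete random variables\<close>

text \<open>
  A discrete random variable is a function on the sample space of a pmf. All alphabets below are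
  countable types, so products of the counting measures are again counting measures. Entropies are
  in bits. Since the library's quantities are real-valued Bochner integrals, they carry their
  intended meaning only when they are finite; for conditional mutual information this is
  guaranteed as soon as the first argument has finite entropy (e.g. a finite range), whatever the
  other two arguments are.
\<close>

definition cond_entropy :: "'o pmf \<Rightarrow> ('o \<Rightarrow> 'a::countable) \<Rightarrow> ('o \<Rightarrow> 'b::countable) \<Rightarrow> real" where
  "cond_entropy p X Z =
     prob_space.conditional_entropy (measure_pmf p) 2 (count_space UNIV) (count_space UNIV) X Z"

definition cond_mutual_info ::
  "'o pmf \<Rightarrow> ('o \<Rightarrow> 'a::countable) \<Rightarrow> ('o \<Rightarrow> 'b::countable) \<Rightarrow> ('o \<Rightarrow> 'c::countable) \<Rightarrow> real" where
  "cond_mutual_info p X Y Z =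
     prob_space.conditional_mutual_information (measure_pmf p) 2
       (count_space UNIV) (count_space UNIV) (count_space UNIV) X Y Z"

definition has_finite_entropy :: "'o pmf \<Rightarrow> ('o \<Rightarrow> 'a::countable) \<Rightarrow> bool" where
  "has_finite_entropy p X \<longleftrightarrow>
     information_space.finite_entropy (measure_pmf p) 2 (count_space UNIV) X (pmf (map_pmf X p))"

text \<open>For finite alphabets the finiteness condition is vacuous.\<close>

lemma has_finite_entropy_finite: "has_finite_entropy (p :: 'o pmf) (X :: 'o \<Rightarrow> 'a::finite)"
proof -
  interpret information_space "measure_pmf p" 2 by unfold_locales simp
  have "distributed (measure_pmf p) (count_space UNIV) X (pmf (map_pmf X p))"
    unfolding distributed_def
    by (auto simp: measure_pmf_eq_density[symmetric] map_pmf_rep_eq[symmetric])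
  then show ?thesis unfolding has_finite_entropy_def finite_entropy_def
    by (auto intro!: integrable_count_space)
qed

section \<open>Two-party protocols\<close>

text \<open>
  Party 1 sends the messages number 0, 2, 4, ... and party 2 the messages number 1, 3, 5, ....
  Messages may be empty, so protocols in which party 2 speaks first are included. The private
  randomness of each party is drawn once and stays part of its view; in addition every message
  (and output) may be a randomized function of the current view. The history and the transcript
  are sequences of messages rather than one flattened bit string: the boundaries between messages
  are seen by both parties, and flattening messages that are not self-delimiting would hide
  communicated information from the transcript.
\<close>

record ('x, 'y, 'a, 'b) protocol =
  rounds :: nat
  coins1 :: "nat pmf"
  coins2 :: "nat pmf"
  msg1 :: "'x \<Rightarrow> nat \<Rightarrow> bool list list \<Rightarrow> bool list pmf"
  msg2 :: "'y \<Rightarrow> nat \<Rightarrow> bool list list \<Rightarrow> bool list pmf"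
  out1 :: "'x \<Rightarrow> nat \<Rightarrow> bool list list \<Rightarrow> 'a pmf"
  out2 :: "'y \<Rightarrow> nat \<Rightarrow> bool list list \<Rightarrow> 'b pmf"

primrec transcript ::
  "('x, 'y, 'a, 'b) protocol \<Rightarrow> 'x \<Rightarrow> nat \<Rightarrow> 'y \<Rightarrow> nat \<Rightarrow> nat \<Rightarrow> bool list list pmf" where
  "transcript P x r1 y r2 0 = return_pmf []"
| "transcript P x r1 y r2 (Suc n) = do {
     ms \<leftarrow> transcript P x r1 y r2 n;
     m \<leftarrow> (if even n then msg1 P x r1 ms else msg2 P y r2 ms);
     return_pmf (ms @ [m])
   }"

text \<open>Joint law of both inputs, the transcript and both outputs.\<close>

definition run_protocol ::
  "('x, 'y, 'a, 'b) protocol \<Rightarrow> ('x \<times> 'y) pmf \<Rightarrow> ('x \<times> 'y \<times> bool list list \<times> 'a \<times> 'b) pmf" where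
  "run_protocol P q = do {
     (x, y) \<leftarrow> q;
     r1 \<leftarrow> coins1 P;
     r2 \<leftarrow> coins2 P;
     ms \<leftarrow> transcript P x r1 y r2 (rounds P);
     a \<leftarrow> out1 P x r1 ms;
     b \<leftarrow> out2 P y r2 ms;
     return_pmf (x, y, ms, a, b)
   }"

definition IC12 :: "('x::countable, 'y::countable, 'a, 'b) protocol \<Rightarrow> ('x \<times> 'y) pmf \<Rightarrow> real" where
  "IC12 P q = cond_mutual_info (run_protocol P q)
     (\<lambda>(x, y, m, a, b). x) (\<lambda>(x, y, m, a, b). m) (\<lambda>(x, y, m, a, b). y)"

definition IC21 :: "('x::countable, 'y::countable, 'a, 'b) protocol \<Rightarrow> ('x \<times> 'y) pmf \<Rightarrow> real" where
  "IC21 P q = cond_mutual_info (run_protocol P q)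
     (\<lambda>(x, y, m, a, b). y) (\<lambda>(x, y, m, a, b). m) (\<lambda>(x, y, m, a, b). x)"

section \<open>Regions\<close>

text \<open>In what follows \<open>p\<close> is the joint law of \<open>(X, Y, A, B)\<close>.\<close>

definition input_law :: "('x \<times> 'y \<times> 'a \<times> 'b) pmf \<Rightarrow> ('x \<times> 'y) pmf" where
  "input_law p = map_pmf (\<lambda>(x, y, a, b). (x, y)) p"

definition realizes ::
  "('x, 'y, 'a, 'b) protocol \<Rightarrow> ('x \<times> 'y \<times> 'a \<times> 'b) pmf \<Rightarrow> bool" where
  "realizes P p \<longleftrightarrow>
     map_pmf (\<lambda>(x, y, m, a, b). (x, y, a, b)) (run_protocol P (input_law p)) = p"

definition info_complexity_region ::
  "('x::countable \<times> 'y::countable \<times> 'a \<times> 'b) pmf \<Rightarrow> (real \<times> real) set" where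
  "info_complexity_region p = {(r1, r2). 0 \<le> r1 \<and> 0 \<le> r2 \<and>
     (\<exists>P :: ('x, 'y, 'a, 'b) protocol. realizes P p \<and>
        IC12 P (input_law p) \<le> r1 \<and> IC21 P (input_law p) \<le> r2)}"

text \<open>
  The law of \<open>(U, V, Q)\<close> when \<open>(U, V)\<close> has law \<open>q\<close> and \<open>Q\<close> is drawn from the conditional law
  \<open>K\<close>; the discrete alphabet of \<open>Q\<close> is encoded in the natural numbers.
\<close>

definition extend_law :: "('u \<times> 'v) pmf \<Rightarrow> ('u \<Rightarrow> 'v \<Rightarrow> nat pmf) \<Rightarrow> ('u \<times> 'v \<times> nat) pmf" where
  "extend_law q K = do { (u, v) \<leftarrow> q; k \<leftarrow> K u v; return_pmf (u, v, k) }"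

definition tension :: "real \<Rightarrow> ('u::countable \<times> 'v::countable) pmf \<Rightarrow> (real \<times> real) set" where
  "tension c q = {(r1, r2). 0 \<le> r1 \<and> 0 \<le> r2 \<and>
     (\<exists>K :: 'u \<Rightarrow> 'v \<Rightarrow> nat pmf.
        let p = extend_law q K;
            U = (\<lambda>(u, v, k). u); V = (\<lambda>(u, v, k). v); Q = (\<lambda>(u, v, k). k)
        in cond_mutual_info p V Q U \<le> r1 \<and>
           cond_mutual_info p U Q V \<le> r2 \<and>
           cond_mutual_info p U V Q \<le> c)}"

definition region_diff :: "(real \<times> real) set \<Rightarrow> (real \<times> real) set \<Rightarrow> (real \<times> real) set" where
  "region_diff S1 S2 = {(a, b). 0 \<le> a \<and> 0 \<le> b \<and> (a, b) +o S2 \<subseteq> S1}"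

definition outer_region ::
  "('x::countable \<times> 'y::countable \<times> 'a::countable \<times> 'b::countable) pmf \<Rightarrow> (real \<times> real) set" where
  "outer_region p = (\<Inter>c\<in>{0..}. region_diff
     (tension c (map_pmf (\<lambda>(x, y, a, b). ((b, y), (a, x))) p))
     (tension c (map_pmf (\<lambda>(x, y, a, b). (y, x)) p)))"

end

theory Submission
  imports Defs
begin

text \<open>
  Given a protocol with transcript \<open>M\<close> and a channel \<open>Q\<close> for \<open>(Y, X)\<close>, draw \<open>Q\<close> conditionally
  independently of the run given the inputs and use \<open>(Q, M)\<close> as the channel for \<open>((B, Y), (A, X))\<close>.
  The law of \<open>(M, A, B)\<close> given the inputs is a product of a function of \<open>(X, M, A)\<close> and a function of
  \<open>(Y, M, B)\<close>. Hence the transcript does not increase the information between the two parties,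
  \<open>I(Y; X | Q M) \<le> I(Y; X | Q)\<close>, and the outputs, being generated locally, do not change it. In
  \<open>I(A X; Q M | B Y)\<close> the same Markov chains bound the part about \<open>X\<close> by \<open>I(X; Q | Y) + I(X; M | Y)\<close>,
  and what remains is \<open>H(A B | X Y) - H(B | Y)\<close>. Taking \<open>Q\<close> constant shows that the shifted pair is
  nonnegative.

  The transcript and \<open>Q\<close> may have infinite entropy, so only the entropies of \<open>X\<close>, \<open>Y\<close>, \<open>A\<close>, \<open>B\<close>,
  conditioned on arbitrary variables, are ever subtracted.
\<close>

section \<open>Conditional entropy\<close>

text \<open>Probabilities are attached to sample points instead of values: variables that induce the
  same partition get the same number, so regrouping or permuting tuples reduces to
  \<open>level_prob_cong\<close>.\<close>

definition level_prob :: "'o pmf \<Rightarrow> ('o \<Rightarrow> 'a) \<Rightarrow> 'o \<Rightarrow> real" where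
  "level_prob p f \<omega> = measure_pmf.prob p {\<omega>'. f \<omega>' = f \<omega>}"

definition surprisal :: "'o pmf \<Rightarrow> ('o \<Rightarrow> 'a) \<Rightarrow> ('o \<Rightarrow> 'b) \<Rightarrow> 'o \<Rightarrow> real" where
  "surprisal p f g \<omega> = - log 2 (level_prob p (\<lambda>\<omega>. (f \<omega>, g \<omega>)) \<omega> / level_prob p g \<omega>)"

definition ent :: "'o pmf \<Rightarrow> ('o \<Rightarrow> 'a) \<Rightarrow> ('o \<Rightarrow> 'b) \<Rightarrow> real" where
  "ent p f g = measure_pmf.expectation p (surprisal p f g)"

text \<open>Conditioning on the constant \<open>()\<close> is no conditioning. As the surprisal is
  nonnegative, integrability says exactly that the entropy is finite.\<close>

definition fin_ent :: "'o pmf \<Rightarrow> ('o \<Rightarrow> 'a) \<Rightarrow> bool" where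
  "fin_ent p f \<longleftrightarrow> integrable (measure_pmf p) (surprisal p f (\<lambda>_. ()))"

lemma level_prob_eq_pmf: "level_prob p f \<omega> = pmf (map_pmf f p) (f \<omega>)"
  by (auto simp: level_prob_def pmf_map vimage_def)

lemma level_prob_cong:
  "(\<And>\<omega>'. f \<omega>' = f \<omega> \<longleftrightarrow> g \<omega>' = g \<omega>) \<Longrightarrow> level_prob p f \<omega> = level_prob p g \<omega>"
  by (simp add: level_prob_def)

lemma level_prob_nonneg [simp]: "0 \<le> level_prob p f \<omega>"
  by (simp add: level_prob_def)

lemma level_prob_pos: "\<omega> \<in> set_pmf p \<Longrightarrow> 0 < level_prob p f \<omega>"
  by (auto simp: level_prob_eq_pmf pmf_positive)

lemma level_prob_neq_0: "\<omega> \<in> set_pmf p \<Longrightarrow> level_prob p f \<omega> \<noteq> 0"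
  using level_prob_pos[of \<omega> p f] by simp

lemma level_prob_mono:
  assumes "\<And>\<omega>'. f \<omega>' = f \<omega> \<Longrightarrow> g \<omega>' = g \<omega>"
  shows "level_prob p f \<omega> \<le> level_prob p g \<omega>"
proof -
  have "{\<omega>'. f \<omega>' = f \<omega>} \<subseteq> {\<omega>'. g \<omega>' = g \<omega>}"
    using assms by blast
  then show ?thesis
    unfolding level_prob_def by (rule measure_pmf.finite_measure_mono) simp
qed

lemma level_prob_unit [simp]: "level_prob p (\<lambda>_. c) \<omega> = 1"
  by (simp add: level_prob_def)

lemma level_prob_map: "level_prob (map_pmf \<phi> p) f (\<phi> \<omega>) = level_prob p (\<lambda>\<omega>. f (\<phi> \<omega>)) \<omega>"
  by (simp add: level_prob_def vimage_def)

lemma surprisal_cong: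
  assumes "\<And>\<omega> \<omega>'. f \<omega>' = f \<omega> \<and> g \<omega>' = g \<omega> \<longleftrightarrow> f' \<omega>' = f' \<omega> \<and> g' \<omega>' = g' \<omega>"
    and "\<And>\<omega> \<omega>'. g \<omega>' = g \<omega> \<longleftrightarrow> g' \<omega>' = g' \<omega>"
  shows "surprisal p f g = surprisal p f' g'"
  using assms by (simp add: surprisal_def level_prob_def fun_eq_iff)

lemma ent_cong:
  assumes "\<And>\<omega> \<omega>'. f \<omega>' = f \<omega> \<and> g \<omega>' = g \<omega> \<longleftrightarrow> f' \<omega>' = f' \<omega> \<and> g' \<omega>' = g' \<omega>"
    and "\<And>\<omega> \<omega>'. g \<omega>' = g \<omega> \<longleftrightarrow> g' \<omega>' = g' \<omega>"
  shows "ent p f g = ent p f' g'"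
proof -
  have "surprisal p f g = surprisal p f' g'"
    by (rule surprisal_cong) (fact assms)+
  then show ?thesis by (simp add: ent_def)
qed

lemma surprisal_map:
  "surprisal (map_pmf \<phi> p) f g (\<phi> \<omega>) = surprisal p (\<lambda>\<omega>. f (\<phi> \<omega>)) (\<lambda>\<omega>. g (\<phi> \<omega>)) \<omega>"
  by (simp add: surprisal_def level_prob_map)

lemma ent_map: "ent (map_pmf \<phi> p) f g = ent p (\<lambda>\<omega>. f (\<phi> \<omega>)) (\<lambda>\<omega>. g (\<phi> \<omega>))"
  by (simp add: ent_def surprisal_map)

lemma fin_ent_map: "fin_ent (map_pmf \<phi> p) f \<longleftrightarrow> fin_ent p (\<lambda>\<omega>. f (\<phi> \<omega>))"
  by (simp add: fin_ent_def surprisal_map)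

lemma surprisal_nonneg: "0 \<le> surprisal p f g \<omega>"
proof -
  have "level_prob p (\<lambda>\<omega>. (f \<omega>, g \<omega>)) \<omega> \<le> level_prob p g \<omega>"
    by (rule level_prob_mono) simp
  then have "level_prob p (\<lambda>\<omega>. (f \<omega>, g \<omega>)) \<omega> / level_prob p g \<omega> \<le> 1"
    using level_prob_nonneg[of p g \<omega>] by (simp add: divide_le_eq_1 not_less less_le)
  then have "log 2 (level_prob p (\<lambda>\<omega>. (f \<omega>, g \<omega>)) \<omega> / level_prob p g \<omega>) \<le> 0"
    \<comment> \<open>Off the support the quotient may be 0, and there
      \<open>log 2 0 = 0\<close>.\<close>
    by (cases "level_prob p (\<lambda>\<omega>. (f \<omega>, g \<omega>)) \<omega> = 0 \<or> level_prob p g \<omega> = 0")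
      (auto simp: log_def less_le divide_le_0_iff)
  then show ?thesis
    by (simp add: surprisal_def)
qed

lemma ent_nonneg: "0 \<le> ent p f g"
  by (simp add: ent_def surprisal_nonneg)

lemma surprisal_chain:
  assumes "\<omega> \<in> set_pmf p"
  shows "surprisal p (\<lambda>\<omega>. (f \<omega>, g \<omega>)) h \<omega> = surprisal p f (\<lambda>\<omega>. (g \<omega>, h \<omega>)) \<omega> + surprisal p g h \<omega>"
proof -
  have "level_prob p (\<lambda>\<omega>. ((f \<omega>, g \<omega>), h \<omega>)) \<omega> = level_prob p (\<lambda>\<omega>. (f \<omega>, g \<omega>, h \<omega>)) \<omega>"
    by (rule level_prob_cong) auto
  then show ?thesis
    using level_prob_pos[OF assms] by (simp add: surprisal_def log_divide level_prob_neq_0[OF assms])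
qed

section \<open>Likelihood ratios and Gibbs' inequality\<close>

text \<open>Gibbs' inequality before taking logarithms, where no integrability is needed.\<close>

lemma nn_expectation_likelihood_ratio:
  fixes R :: "'a \<Rightarrow> 'b \<Rightarrow> real"
  assumes nonneg: "\<And>x w. 0 \<le> R x w"
    and mass: "\<And>w. (\<integral>\<^sup>+x. R x w \<partial>count_space UNIV) \<le> 1"
  shows "(\<integral>\<^sup>+\<omega>. R (X \<omega>) (W \<omega>) * level_prob p W \<omega> / level_prob p (\<lambda>\<omega>. (X \<omega>, W \<omega>)) \<omega> \<partial>measure_pmf p) \<le> 1"
proof -
  let ?P = "pmf (map_pmf (\<lambda>\<omega>. (X \<omega>, W \<omega>)) p)" and ?Q = "pmf (map_pmf W p)"
  have "(\<integral>\<^sup>+\<omega>. R (X \<omega>) (W \<omega>) * level_prob p W \<omega> / level_prob p (\<lambda>\<omega>. (X \<omega>, W \<omega>)) \<omega> \<partial>measure_pmf p)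
      = (\<integral>\<^sup>+z. (case z of (x, w) \<Rightarrow> ennreal (R x w * ?Q w / ?P (x, w))) \<partial>measure_pmf (map_pmf (\<lambda>\<omega>. (X \<omega>, W \<omega>)) p))"
    by (simp add: level_prob_eq_pmf)
  also have "\<dots> = (\<integral>\<^sup>+z. ?P z * (case z of (x, w) \<Rightarrow> ennreal (R x w * ?Q w / ?P (x, w))) \<partial>count_space UNIV)"
    by (rule nn_integral_measure_pmf)
  \<comment> \<open>Where \<open>?P (x, w) = 0\<close> the left integrand vanishes and the right one
    need not, so this is only an inequality.\<close>
  also have "\<dots> \<le> (\<integral>\<^sup>+z. (case z of (x, w) \<Rightarrow> ennreal (?Q w) * ennreal (R x w)) \<partial>count_space UNIV)"
    by (intro nn_integral_mono) (auto simp: ennreal_mult'[symmetric] nonneg split: prod.split)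
  also have "\<dots> = (\<integral>\<^sup>+w. \<integral>\<^sup>+x. ennreal (?Q w) * ennreal (R x w) \<partial>count_space UNIV \<partial>count_space UNIV)"
    by (subst nn_integral_snd_count_space[symmetric]) simp
  also have "\<dots> = (\<integral>\<^sup>+w. ennreal (?Q w) * (\<integral>\<^sup>+x. ennreal (R x w) \<partial>count_space UNIV) \<partial>count_space UNIV)"
    by (simp add: nn_integral_cmult)
  also have "\<dots> \<le> (\<integral>\<^sup>+w. ennreal (?Q w) * 1 \<partial>count_space UNIV)"
    by (intro nn_integral_mono mult_left_mono mass) auto
  also have "\<dots> = 1"
    by (simp add: nn_integral_pmf_eq_1)
  finally show ?thesis .
qed

lemma expectation_le_1_of_nn:
  assumes "(\<integral>\<^sup>+\<omega>. ennreal (u \<omega>) \<partial>measure_pmf p) \<le> 1" "\<And>\<omega>. 0 \<le> u \<omega>"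
  shows "integrable (measure_pmf p) u" "measure_pmf.expectation p u \<le> 1"
proof -
  show i: "integrable (measure_pmf p) u"
    using assms by (intro integrableI_nonneg) (auto simp: less_top[symmetric] top_unique)
  show "measure_pmf.expectation p u \<le> 1"
    using assms nn_integral_eq_integral[OF i]
    by (metis (no_types, lifting) AE_I2 ennreal_le_1 )
qed

text \<open>From \<open>log 2 u \<le> (u - 1) / ln 2\<close>, whose right side is integrable with
  expectation at most 0. Several ratios are allowed because only the total \<open>D\<close> has to
  be integrable, not each logarithm.\<close>

lemma gibbs_inequality:
  assumes "finite I"
    and int: "integrable (measure_pmf p) D"
    and D: "\<And>\<omega>. \<omega> \<in> set_pmf p \<Longrightarrow> D \<omega> = (\<Sum>i\<in>I. log 2 (u i \<omega>))"
    and pos: "\<And>i \<omega>. i \<in> I \<Longrightarrow> \<omega> \<in> set_pmf p \<Longrightarrow> 0 < u i \<omega>"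
    and nonneg: "\<And>i \<omega>. i \<in> I \<Longrightarrow> 0 \<le> u i \<omega>"
    and le1: "\<And>i. i \<in> I \<Longrightarrow> (\<integral>\<^sup>+\<omega>. ennreal (u i \<omega>) \<partial>measure_pmf p) \<le> 1"
  shows "measure_pmf.expectation p D \<le> 0"
proof -
  note u = expectation_le_1_of_nn[OF le1 nonneg]
  have "measure_pmf.expectation p D \<le> measure_pmf.expectation p (\<lambda>\<omega>. \<Sum>i\<in>I. (u i \<omega> - 1) / ln 2)"
  proof (intro integral_mono_AE int)
    show "integrable (measure_pmf p) (\<lambda>\<omega>. \<Sum>i\<in>I. (u i \<omega> - 1) / ln 2)"
      using u by auto
    show "AE \<omega> in measure_pmf p. D \<omega> \<le> (\<Sum>i\<in>I. (u i \<omega> - 1) / ln 2)"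
      using pos
      by (auto simp: AE_measure_pmf_iff D log_def intro!: sum_mono divide_right_mono ln_le_minus_one)
  qed
  also have "\<dots> = (\<Sum>i\<in>I. (measure_pmf.expectation p (u i) - 1) / ln 2)"
    using u by (subst Bochner_Integration.integral_sum) auto
  also have "\<dots> \<le> 0"
    using u by (intro sum_nonpos) (auto simp: divide_le_0_iff)
  finally show ?thesis .
qed

section \<open>Conditional likelihood ratios: integrability, chain rule, conditioning\<close>

lemma nn_level_prob_slice:
  "(\<integral>\<^sup>+x. pmf (map_pmf (\<lambda>\<omega>. (f \<omega>, g \<omega>)) p) (x, z) \<partial>count_space UNIV) = ennreal (pmf (map_pmf g p) z)"
proof -
  let ?q = "map_pmf (\<lambda>\<omega>. (f \<omega>, g \<omega>)) p"
  have "ennreal (pmf (map_pmf g p) z) = ennreal (pmf (map_pmf snd ?q) z)"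
    by (simp add: map_pmf_comp)
  also have "\<dots> = (\<integral>\<^sup>+y. ennreal (pmf ?q y) * indicator (snd -` {z}) y \<partial>count_space UNIV)"
    by (simp only: ennreal_pmf_map nn_integral_measure_pmf)
  also have "\<dots> = (\<integral>\<^sup>+x. \<integral>\<^sup>+w. ennreal (pmf ?q (x, w)) * indicator {z} w \<partial>count_space UNIV \<partial>count_space UNIV)"
    by (subst nn_integral_fst_count_space[symmetric]) (auto simp: indicator_def intro!: nn_integral_cong)
  also have "\<dots> = (\<integral>\<^sup>+x. ennreal (pmf ?q (x, z)) \<partial>count_space UNIV)"
    by (intro nn_integral_cong) (simp add: nn_integral_indicator_singleton)
  finally show ?thesis by simp
qed

text \<open>The integrand compares the law that makes \<open>f\<close> and \<open>g\<close>
  independent given \<open>h\<close> with the true joint law; \<open>R\<close> is the conditional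
  law of \<open>f\<close> given \<open>h\<close>. Minus the logarithm of this ratio is the pointwise
  conditional mutual information.\<close>

lemma nn_cond_ratio:
  fixes f :: "'o \<Rightarrow> 'a" and g :: "'o \<Rightarrow> 'b" and h :: "'o \<Rightarrow> 'c"
  shows "(\<integral>\<^sup>+\<omega>. level_prob p (\<lambda>\<omega>. (f \<omega>, h \<omega>)) \<omega> * level_prob p (\<lambda>\<omega>. (g \<omega>, h \<omega>)) \<omega> /
     (level_prob p h \<omega> * level_prob p (\<lambda>\<omega>. (f \<omega>, g \<omega>, h \<omega>)) \<omega>) \<partial>measure_pmf p) \<le> 1"
proof -
  let ?R = "\<lambda>x (y, z). pmf (map_pmf (\<lambda>\<omega>. (f \<omega>, h \<omega>)) p) (x, z) / pmf (map_pmf h p) z"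
  have "(\<integral>\<^sup>+\<omega>. ?R (f \<omega>) (g \<omega>, h \<omega>) * level_prob p (\<lambda>\<omega>. (g \<omega>, h \<omega>)) \<omega> /
     level_prob p (\<lambda>\<omega>. (f \<omega>, g \<omega>, h \<omega>)) \<omega> \<partial>measure_pmf p) \<le> 1"
  proof (rule nn_expectation_likelihood_ratio)
    fix w :: "'b \<times> 'c"
    obtain y z where w: "w = (y, z)" by force
    have "(\<integral>\<^sup>+x. ?R x w \<partial>count_space UNIV)
        = (\<integral>\<^sup>+x. pmf (map_pmf (\<lambda>\<omega>. (f \<omega>, h \<omega>)) p) (x, z) \<partial>count_space UNIV) * ennreal (1 / pmf (map_pmf h p) z)"
      by (subst nn_integral_multc[symmetric]) (auto simp: w ennreal_mult'[symmetric])
    also have "\<dots> = ennreal (pmf (map_pmf h p) z / pmf (map_pmf h p) z)"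
      unfolding nn_level_prob_slice by (simp add: ennreal_mult'[symmetric])
    also have "\<dots> \<le> 1" by simp
    finally show "(\<integral>\<^sup>+x. ?R x w \<partial>count_space UNIV) \<le> 1" .
  qed auto
  then show ?thesis
    by (simp add: level_prob_eq_pmf)
qed

text \<open>Conditioning can raise the surprisal pointwise, so the unconditional surprisal alone is
  no bound. The excess is the logarithm of the ratio \<open>?u\<close> of the independent law to the
  joint law, at most \<open>?u / ln 2\<close>, which is integrable.\<close>

lemma surprisal_integrable:
  assumes "fin_ent p f"
  shows "integrable (measure_pmf p) (surprisal p f g)"
proof -
  let ?u = "\<lambda>\<omega>. level_prob p (\<lambda>\<omega>. (f \<omega>, ())) \<omega> * level_prob p (\<lambda>\<omega>. (g \<omega>, ())) \<omega> /
     (level_prob p (\<lambda>_. ()) \<omega> * level_prob p (\<lambda>\<omega>. (f \<omega>, g \<omega>, ())) \<omega>)"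
  have u: "integrable (measure_pmf p) ?u"
    by (rule expectation_le_1_of_nn(1)[OF nn_cond_ratio]) simp
  show ?thesis
  proof (rule Bochner_Integration.integrable_bound)
    show "integrable (measure_pmf p) (\<lambda>\<omega>. surprisal p f (\<lambda>_. ()) \<omega> + ?u \<omega> / ln 2)"
      using assms u unfolding fin_ent_def
      by (intro Bochner_Integration.integrable_add integrable_divide)
    have "surprisal p f g \<omega> \<le> surprisal p f (\<lambda>_. ()) \<omega> + ?u \<omega> / ln 2" if \<omega>: "\<omega> \<in> set_pmf p" for \<omega>
    proof -
      have [simp]: "level_prob p (\<lambda>\<omega>. (g \<omega>, ())) \<omega> = level_prob p g \<omega>"
        "level_prob p (\<lambda>\<omega>. (f \<omega>, g \<omega>, ())) \<omega> = level_prob p (\<lambda>\<omega>. (f \<omega>, g \<omega>)) \<omega>"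
        by (auto intro!: level_prob_cong)
      have pos: "0 < ?u \<omega>"
        by (simp add: level_prob_pos[OF \<omega>])
      have "surprisal p f g \<omega> = surprisal p f (\<lambda>_. ()) \<omega> + log 2 (?u \<omega>)"
        using level_prob_pos[OF \<omega>]
        by (simp add: surprisal_def log_divide log_mult level_prob_neq_0[OF \<omega>])
      also have "log 2 (?u \<omega>) \<le> ?u \<omega> / ln 2"
        using ln_le_minus_one[OF pos] unfolding log_def by (intro divide_right_mono) auto
      finally show ?thesis by simp
    qed
    then have "norm (surprisal p f g \<omega>) \<le> norm (surprisal p f (\<lambda>_. ()) \<omega> + ?u \<omega> / ln 2)"
      if "\<omega> \<in> set_pmf p" for \<omega>
      using order_trans[OF _ abs_ge_self] that unfolding real_norm_def abs_of_nonneg[OF surprisal_nonneg]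
      by blast
    then show "AE \<omega> in measure_pmf p. norm (surprisal p f g \<omega>) \<le> norm (surprisal p f (\<lambda>_. ()) \<omega> + ?u \<omega> / ln 2)"
      by (rule AE_pmfI)
  qed simp
qed

lemma fin_ent_pair:
  assumes "fin_ent p f" "fin_ent p g"
  shows "fin_ent p (\<lambda>\<omega>. (f \<omega>, g \<omega>))"
  unfolding fin_ent_def
proof (rule integrable_cong_AE_imp)
  show "integrable (measure_pmf p) (\<lambda>\<omega>. surprisal p f (\<lambda>\<omega>. (g \<omega>, ())) \<omega> + surprisal p g (\<lambda>_. ()) \<omega>)"
    using surprisal_integrable[OF assms(1)] assms(2) unfolding fin_ent_def
    by (rule Bochner_Integration.integrable_add)
qed (auto simp: AE_measure_pmf_iff surprisal_chain)

lemma ent_chain: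
  assumes "fin_ent p f" "fin_ent p g"
  shows "ent p (\<lambda>\<omega>. (f \<omega>, g \<omega>)) h = ent p f (\<lambda>\<omega>. (g \<omega>, h \<omega>)) + ent p g h"
proof -
  have "ent p (\<lambda>\<omega>. (f \<omega>, g \<omega>)) h
      = measure_pmf.expectation p (\<lambda>\<omega>. surprisal p f (\<lambda>\<omega>. (g \<omega>, h \<omega>)) \<omega> + surprisal p g h \<omega>)"
    unfolding ent_def by (intro integral_cong_AE) (auto simp: AE_measure_pmf_iff surprisal_chain)
  then show ?thesis
    using assms by (simp add: ent_def surprisal_integrable)
qed

text \<open>The difference of the two surprisals is the logarithm of the single ratio in
  \<open>nn_cond_ratio\<close>, so Gibbs' inequality applies whatever the entropies of
  \<open>g\<close> and \<open>h\<close> are.\<close>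

lemma ent_conditioning_le:
  assumes "fin_ent p f"
  shows "ent p f (\<lambda>\<omega>. (g \<omega>, h \<omega>)) \<le> ent p f h"
proof -
  let ?D = "\<lambda>\<omega>. surprisal p f (\<lambda>\<omega>. (g \<omega>, h \<omega>)) \<omega> - surprisal p f h \<omega>"
  have "measure_pmf.expectation p ?D \<le> 0"
  proof (rule gibbs_inequality[where I = "{()}", OF _ _ _ _ _ nn_cond_ratio[of p f h g]])
    show "integrable (measure_pmf p) ?D"
      by (intro Bochner_Integration.integrable_diff surprisal_integrable assms)
  qed (auto simp: surprisal_def log_divide log_mult level_prob_neq_0 level_prob_pos)
  then show ?thesis
    by (simp add: ent_def Bochner_Integration.integral_diff surprisal_integrable[OF assms])
qed

section \<open>Conditional independence\<close>

definition cond_indep :: "'o pmf \<Rightarrow> ('o \<Rightarrow> 'a) \<Rightarrow> ('o \<Rightarrow> 'b) \<Rightarrow> ('o \<Rightarrow> 'c) \<Rightarrow> bool" where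
  "cond_indep p f g h \<longleftrightarrow> (\<forall>\<omega>\<in>set_pmf p.
     level_prob p (\<lambda>\<omega>. (f \<omega>, g \<omega>, h \<omega>)) \<omega> * level_prob p h \<omega> =
     level_prob p (\<lambda>\<omega>. (f \<omega>, h \<omega>)) \<omega> * level_prob p (\<lambda>\<omega>. (g \<omega>, h \<omega>)) \<omega>)"

text \<open>The surprisals already agree at every point of the support.\<close>

lemma ent_cond_indep:
  assumes "cond_indep p f g h"
  shows "ent p f (\<lambda>\<omega>. (g \<omega>, h \<omega>)) = ent p f h"
  unfolding ent_def using assms
  by (intro integral_cong_AE)
    (auto simp: AE_measure_pmf_iff surprisal_def cond_indep_def frac_eq_eq level_prob_neq_0
      intro!: arg_cong[where f = "log 2"])

text \<open>Summing out one or both of \<open>x\<close> and \<open>y\<close> gives every marginal as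
  a product of \<open>\<alpha>\<close>, \<open>\<beta>\<close> and their sums, and the two sides of
  the product rule contain the same four factors. The weights are not normalised, so any splitting
  of the joint law will do.\<close>

lemma cond_indep_factor:
  assumes "\<And>x y z. ennreal (pmf (map_pmf (\<lambda>\<omega>. (f \<omega>, g \<omega>, h \<omega>)) p) (x, y, z)) = \<alpha> x z * \<beta> y z"
  shows "cond_indep p f g h"
proof -
  let ?A = "\<lambda>z. \<integral>\<^sup>+x. \<alpha> x z \<partial>count_space UNIV" and ?B = "\<lambda>z. \<integral>\<^sup>+y. \<beta> y z \<partial>count_space UNIV"
  have gh: "ennreal (pmf (map_pmf (\<lambda>\<omega>. (g \<omega>, h \<omega>)) p) (y, z)) = ?A z * \<beta> y z" for y z
    by (subst nn_level_prob_slice[where f = f, symmetric]) (simp add: assms nn_integral_multc)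
  have h: "ennreal (pmf (map_pmf h p) z) = ?A z * ?B z" for z
    by (subst nn_level_prob_slice[where f = g, symmetric]) (simp add: gh nn_integral_cmult)
  \<comment> \<open>\<open>nn_level_prob_slice\<close> sums out the first coordinate, so
    \<open>g\<close> is moved to the front.\<close>
  have "pmf (map_pmf (\<lambda>\<omega>. (g \<omega>, f \<omega>, h \<omega>)) p) (y, x, z) = pmf (map_pmf (\<lambda>\<omega>. (f \<omega>, g \<omega>, h \<omega>)) p) (x, y, z)" for x y z
    unfolding pmf_map by (rule arg_cong[where f = "measure_pmf.prob p"]) auto
  then have fh: "ennreal (pmf (map_pmf (\<lambda>\<omega>. (f \<omega>, h \<omega>)) p) (x, z)) = \<alpha> x z * ?B z" for x z
    by (subst nn_level_prob_slice[where f = g, symmetric]) (simp add: assms nn_integral_cmult)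
  have "ennreal (level_prob p (\<lambda>\<omega>. (f \<omega>, g \<omega>, h \<omega>)) \<omega> * level_prob p h \<omega>) =
     ennreal (level_prob p (\<lambda>\<omega>. (f \<omega>, h \<omega>)) \<omega> * level_prob p (\<lambda>\<omega>. (g \<omega>, h \<omega>)) \<omega>)" for \<omega>
    unfolding level_prob_eq_pmf ennreal_mult'[OF pmf_nonneg] assms gh h fh by (simp only: mult_ac)
  then show ?thesis
    by (simp add: cond_indep_def)
qed

section \<open>Relation to the measure-theoretic information measures\<close>

lemma distributed_count_space:
  "distributed (measure_pmf p) (count_space UNIV) X (pmf (map_pmf X p))"
  unfolding distributed_def
  by (auto simp: measure_pmf_eq_density[symmetric] map_pmf_rep_eq[symmetric])

lemma integral_count_space_pmf:
  "(\<integral>x. pmf q x * h x \<partial>count_space UNIV) = measure_pmf.expectation q h"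
  by (simp add: measure_pmf_eq_density[of q] integral_density)

lemma integrable_count_space_pmf:
  fixes h :: "'a \<Rightarrow> real"
  shows "integrable (count_space UNIV) (\<lambda>x. pmf q x * h x) \<longleftrightarrow> integrable (measure_pmf q) h"
  by (simp add: measure_pmf_eq_density[of q] integrable_density)

lemma has_finite_entropy_imp_fin_ent:
  assumes "has_finite_entropy p X"
  shows "fin_ent p X"
proof -
  interpret information_space "measure_pmf p" 2 by unfold_locales simp
  have "integrable (count_space UNIV) (\<lambda>x. pmf (map_pmf X p) x * log 2 (pmf (map_pmf X p) x))"
    using assms by (simp add: has_finite_entropy_def finite_entropy_def)
  then have "integrable (measure_pmf p) (\<lambda>\<omega>. - log 2 (pmf (map_pmf X p) (X \<omega>)))"
    by (simp add: integrable_count_space_pmf)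
  moreover have "surprisal p X (\<lambda>_. ()) \<omega> = - log 2 (pmf (map_pmf X p) (X \<omega>))" for \<omega>
  proof -
    have "level_prob p (\<lambda>\<omega>. (X \<omega>, ())) \<omega> = level_prob p X \<omega>"
      by (rule level_prob_cong) simp
    then show ?thesis by (simp add: surprisal_def level_prob_eq_pmf)
  qed
  then have "surprisal p X (\<lambda>_. ()) = (\<lambda>\<omega>. - log 2 (pmf (map_pmf X p) (X \<omega>)))"
    by (rule ext)
  ultimately show ?thesis
    unfolding fin_ent_def by simp
qed

lemma fin_ent_finite: "fin_ent p (X :: 'o \<Rightarrow> 'a::finite)"
  by (rule has_finite_entropy_imp_fin_ent[OF has_finite_entropy_finite])

lemma sigma_finite_count_space: "sigma_finite_measure (count_space (UNIV :: 'a::countable set))"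
  by (rule sigma_finite_measure_count_space_countable) simp

text \<open>On the support, the logarithm of the density of the joint law with respect to the
  product law is a difference of two surprisals of \<open>X\<close>. Both are integrable by the
  finite entropy of \<open>X\<close>, so the integral may be split.\<close>

lemma mutual_information_eq_ent:
  fixes X :: "'o \<Rightarrow> 'a::countable" and Y :: "'o \<Rightarrow> 'b::countable"
  assumes "fin_ent p X"
  shows "prob_space.mutual_information (measure_pmf p) (2 :: real) (count_space UNIV) (count_space UNIV) X Y
    = ent p X (\<lambda>_. ()) - ent p X Y"
proof -
  interpret information_space "measure_pmf p" 2 by unfold_locales simp
  let ?P = "\<lambda>f. pmf (map_pmf f p)" and ?XY = "\<lambda>\<omega>. (X \<omega>, Y \<omega>)"
  have pair: "count_space UNIV \<Otimes>\<^sub>M count_space UNIV = (count_space UNIV :: ('a \<times> 'b) measure)"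
    by (subst pair_measure_countable) auto
  have "prob_space.mutual_information (measure_pmf p) 2 (count_space UNIV) (count_space UNIV) X Y
      = (\<integral>z. ?P ?XY z * log 2 (?P ?XY z / (?P X (fst z) * ?P Y (snd z))) \<partial>count_space UNIV)"
    unfolding pair[symmetric]
    by (subst mutual_information_distr[OF sigma_finite_count_space sigma_finite_count_space
      distributed_count_space _ distributed_count_space _ distributed_count_space[of p ?XY, folded pair]])
      auto
  also have "\<dots> = measure_pmf.expectation p (\<lambda>\<omega>. log 2 (?P ?XY (?XY \<omega>) / (?P X (X \<omega>) * ?P Y (Y \<omega>))))"
    unfolding integral_count_space_pmf by simp
  also have "\<dots> = measure_pmf.expectation p (\<lambda>\<omega>. surprisal p X (\<lambda>_. ()) \<omega> - surprisal p X Y \<omega>)"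
  proof (intro integral_cong_AE)
    have "log 2 (?P ?XY (?XY \<omega>) / (?P X (X \<omega>) * ?P Y (Y \<omega>))) = surprisal p X (\<lambda>_. ()) \<omega> - surprisal p X Y \<omega>"
      if "\<omega> \<in> set_pmf p" for \<omega>
    proof -
      have "level_prob p (\<lambda>\<omega>. (X \<omega>, ())) \<omega> = level_prob p X \<omega>"
        by (rule level_prob_cong) simp
      then show ?thesis
        using level_prob_neq_0[OF that, of X] level_prob_neq_0[OF that, of Y] level_prob_neq_0[OF that, of ?XY]
          level_prob_pos[OF that, of X] level_prob_pos[OF that, of Y] level_prob_pos[OF that, of ?XY]
        by (simp add: surprisal_def level_prob_eq_pmf[symmetric, where p = p and f = X] level_prob_eq_pmf[symmetric, where p = p and f = Y]
          level_prob_eq_pmf[symmetric, where p = p and f = ?XY] log_divide log_mult)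
    qed
    then show "AE \<omega> in measure_pmf p. log 2 (?P ?XY (?XY \<omega>) / (?P X (X \<omega>) * ?P Y (Y \<omega>)))
        = surprisal p X (\<lambda>_. ()) \<omega> - surprisal p X Y \<omega>"
      by (rule AE_pmfI)
  qed auto
  also have "\<dots> = ent p X (\<lambda>_. ()) - ent p X Y"
    unfolding ent_def
    by (rule Bochner_Integration.integral_diff) (rule surprisal_integrable[OF assms])+
  finally show ?thesis .
qed

text \<open>The library defines I(X;Y|Z) as I(X;(Y,Z)) - I(X;Z); the unconditional entropy of
  \<open>X\<close> cancels in the difference.\<close>

lemma cond_mutual_info_eq_ent:
  fixes X :: "'o \<Rightarrow> 'a::countable" and Y :: "'o \<Rightarrow> 'b::countable" and Z :: "'o \<Rightarrow> 'c::countable"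
  assumes "fin_ent p X"
  shows "cond_mutual_info p X Y Z = ent p X Z - ent p X (\<lambda>\<omega>. (Y \<omega>, Z \<omega>))"
proof -
  interpret information_space "measure_pmf p" 2 by unfold_locales simp
  have pair: "count_space UNIV \<Otimes>\<^sub>M count_space UNIV = (count_space UNIV :: ('b \<times> 'c) measure)"
    by (subst pair_measure_countable) auto
  show ?thesis
    unfolding cond_mutual_info_def prob_space.conditional_mutual_information_def[OF measure_pmf.prob_space_axioms] pair
    by (simp add: mutual_information_eq_ent[OF assms])
qed

text \<open>Both sides are the same Bochner integral up to a change of variables, so they agree also
  in the default value for a nonintegrable surprisal.\<close>

lemma cond_entropy_eq_ent:
  fixes X :: "'o \<Rightarrow> 'a::countable" and Z :: "'o \<Rightarrow> 'b::countable"
  shows "cond_entropy p X Z = ent p X Z"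
proof -
  interpret information_space "measure_pmf p" 2 by unfold_locales simp
  let ?P = "\<lambda>f. pmf (map_pmf f p)" and ?XZ = "\<lambda>\<omega>. (X \<omega>, Z \<omega>)"
  have pair: "count_space UNIV \<Otimes>\<^sub>M count_space UNIV = (count_space UNIV :: ('a \<times> 'b) measure)"
    by (subst pair_measure_countable) auto
  have "cond_entropy p X Z = - (\<integral>(x, z). ?P ?XZ (x, z) * log 2 (?P ?XZ (x, z) / ?P Z z) \<partial>count_space UNIV)"
    unfolding cond_entropy_def pair[symmetric]
    by (rule conditional_entropy_generic_eq)
      (auto simp: distributed_count_space pair sigma_finite_count_space)
  also have "\<dots> = - (\<integral>y. ?P ?XZ y * log 2 (?P ?XZ y / ?P Z (snd y)) \<partial>count_space UNIV)"
    by (simp add: split_beta')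
  also have "\<dots> = measure_pmf.expectation p (\<lambda>\<omega>. - log 2 (?P ?XZ (?XZ \<omega>) / ?P Z (Z \<omega>)))"
    unfolding integral_count_space_pmf by simp
  also have "\<dots> = ent p X Z"
    unfolding ent_def surprisal_def level_prob_eq_pmf ..
  finally show ?thesis .
qed

section \<open>Inequalities for entropies\<close>

text \<open>
  Think of \<open>F x m * G y m\<close> as the likelihood of \<open>M = m\<close> given \<open>X = x\<close> and \<open>Y = y\<close>. The information
  between \<open>X\<close> and \<open>Y\<close> given \<open>Q\<close>, \<open>M\<close> is at most the divergence of their joint law from any product
  law; choose the laws of \<open>X\<close> and \<open>Y\<close> given \<open>Q\<close> reweighted by \<open>F\<close> and \<open>G\<close>. The three likelihood
  ratios \<open>u 0\<close>, \<open>u 1\<close>, \<open>u 2\<close> account for \<open>X\<close>, \<open>Y\<close> and the normalising constant; their logarithms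
  need not be integrable separately.
\<close>

lemma mutual_info_factor_le:
  fixes X :: "'o \<Rightarrow> 'x::finite" and Y :: "'o \<Rightarrow> 'y::finite" and F :: "'x \<Rightarrow> 'm \<Rightarrow> real"
  assumes F: "\<And>x m. 0 \<le> F x m" and G: "\<And>y m. 0 \<le> G y m"
    and mass: "\<And>x y. (\<integral>\<^sup>+m. ennreal (F x m * G y m) \<partial>count_space UNIV) \<le> 1"
    and law: "\<And>\<omega>. \<omega> \<in> set_pmf p \<Longrightarrow> level_prob p (\<lambda>\<omega>. (X \<omega>, Y \<omega>, Q \<omega>, M \<omega>)) \<omega>
      = level_prob p (\<lambda>\<omega>. (X \<omega>, Y \<omega>, Q \<omega>)) \<omega> * F (X \<omega>) (M \<omega>) * G (Y \<omega>) (M \<omega>)"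
  shows "ent p Y (\<lambda>\<omega>. (Q \<omega>, M \<omega>)) - ent p Y (\<lambda>\<omega>. (X \<omega>, Q \<omega>, M \<omega>))
    \<le> ent p Y Q - ent p Y (\<lambda>\<omega>. (X \<omega>, Q \<omega>))"
proof -
  define px where "px x q = pmf (map_pmf (\<lambda>\<omega>. (X \<omega>, Q \<omega>)) p) (x, q)" for x q
  define py where "py y q = pmf (map_pmf (\<lambda>\<omega>. (Y \<omega>, Q \<omega>)) p) (y, q)" for y q
  define pq where "pq q = pmf (map_pmf Q p) q" for q
  \<comment> \<open>\<open>px x q * F x m / f q m\<close> is the law of \<open>X\<close> given
    \<open>Q = q\<close> reweighted by \<open>F\<close>, with \<open>f\<close> as normaliser;
    \<open>g\<close> plays the same part for \<open>Y\<close>.\<close>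
  define f where "f q m = (\<Sum>x\<in>UNIV. px x q * F x m)" for q m
  define g where "g q m = (\<Sum>y\<in>UNIV. py y q * G y m)" for q m
  have nonneg [simp]: "0 \<le> px x q" "0 \<le> py y q" "0 \<le> pq q" "0 \<le> f q m" "0 \<le> g q m" for x y q m
    by (auto simp: px_def py_def pq_def f_def g_def F G intro!: sum_nonneg)
  have slice: "(\<Sum>x\<in>UNIV. px x q) = pq q" "(\<Sum>y\<in>UNIV. py y q) = pq q" for q
    using nn_level_prob_slice[of X Q p q] nn_level_prob_slice[of Y Q p q]
    by (simp_all add: nn_integral_count_space_finite px_def py_def pq_def sum_nonneg)

  define u where "u i \<omega> = (if i = (0::nat)
      then px (X \<omega>) (Q \<omega>) * F (X \<omega>) (M \<omega>) / f (Q \<omega>) (M \<omega>) * level_prob p (\<lambda>\<omega>. (Q \<omega>, M \<omega>)) \<omega> /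
        level_prob p (\<lambda>\<omega>. (X \<omega>, Q \<omega>, M \<omega>)) \<omega>
    else if i = 1
      then py (Y \<omega>) (Q \<omega>) * G (Y \<omega>) (M \<omega>) / g (Q \<omega>) (M \<omega>) * level_prob p (\<lambda>\<omega>. (Q \<omega>, M \<omega>)) \<omega> /
        level_prob p (\<lambda>\<omega>. (Y \<omega>, Q \<omega>, M \<omega>)) \<omega>
    else f (Q \<omega>) (M \<omega>) * g (Q \<omega>) (M \<omega>) / pq (Q \<omega>) ^ 2 * level_prob p Q \<omega> /
        level_prob p (\<lambda>\<omega>. (M \<omega>, Q \<omega>)) \<omega>)" for i \<omega>
  let ?D = "\<lambda>\<omega>. (surprisal p Y (\<lambda>\<omega>. (Q \<omega>, M \<omega>)) \<omega> - surprisal p Y (\<lambda>\<omega>. (X \<omega>, Q \<omega>, M \<omega>)) \<omega>) -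
    (surprisal p Y Q \<omega> - surprisal p Y (\<lambda>\<omega>. (X \<omega>, Q \<omega>)) \<omega>)"
  have fin: "fin_ent p Y" by (rule fin_ent_finite)
  have "measure_pmf.expectation p ?D \<le> 0"
  proof (rule gibbs_inequality[where I = "{0, 1, 2}" and u = u])
    show "integrable (measure_pmf p) ?D"
      by (intro Bochner_Integration.integrable_diff surprisal_integrable fin)
    fix i :: nat assume "i \<in> {0, 1, 2}"
    then consider "i = 0" | "i = 1" | "i = 2" by auto
    then show "(\<integral>\<^sup>+\<omega>. ennreal (u i \<omega>) \<partial>measure_pmf p) \<le> 1"
    proof cases
      case 1
      have "(\<integral>\<^sup>+\<omega>. ennreal ((\<lambda>x (q, m). px x q * F x m / f q m) (X \<omega>) (Q \<omega>, M \<omega>) *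
          level_prob p (\<lambda>\<omega>. (Q \<omega>, M \<omega>)) \<omega> / level_prob p (\<lambda>\<omega>. (X \<omega>, Q \<omega>, M \<omega>)) \<omega>) \<partial>measure_pmf p) \<le> 1"
      proof (rule nn_expectation_likelihood_ratio)
        show "(\<integral>\<^sup>+x. ennreal ((\<lambda>(q, m). px x q * F x m / f q m) w) \<partial>count_space UNIV) \<le> 1" for w
          by (cases w) (auto simp: nn_integral_count_space_finite F sum_divide_distrib[symmetric] f_def[symmetric])
      qed (auto simp: F)
      then show ?thesis by (simp add: 1 u_def)
    next
      case 2
      have "(\<integral>\<^sup>+\<omega>. ennreal ((\<lambda>y (q, m). py y q * G y m / g q m) (Y \<omega>) (Q \<omega>, M \<omega>) *
          level_prob p (\<lambda>\<omega>. (Q \<omega>, M \<omega>)) \<omega> / level_prob p (\<lambda>\<omega>. (Y \<omega>, Q \<omega>, M \<omega>)) \<omega>) \<partial>measure_pmf p) \<le> 1"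
      proof (rule nn_expectation_likelihood_ratio)
        show "(\<integral>\<^sup>+y. ennreal ((\<lambda>(q, m). py y q * G y m / g q m) w) \<partial>count_space UNIV) \<le> 1" for w
          by (cases w) (auto simp: nn_integral_count_space_finite G sum_divide_distrib[symmetric] g_def[symmetric])
      qed (auto simp: G)
      then show ?thesis by (simp add: 2 u_def)
    next
      case 3
      have "(\<integral>\<^sup>+\<omega>. ennreal ((\<lambda>m q. f q m * g q m / pq q ^ 2) (M \<omega>) (Q \<omega>) *
          level_prob p Q \<omega> / level_prob p (\<lambda>\<omega>. (M \<omega>, Q \<omega>)) \<omega>) \<partial>measure_pmf p) \<le> 1"
      proof (rule nn_expectation_likelihood_ratio)
        fix q
        \<comment> \<open>Expanding the product of sums averages \<open>F x m * G y m\<close> over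
          \<open>x\<close> and \<open>y\<close> drawn independently given \<open>q\<close>. Hence
          the total over \<open>m\<close> is at most 1 by \<open>mass\<close>.\<close>
        have "(\<integral>\<^sup>+m. ennreal (f q m * g q m / pq q ^ 2) \<partial>count_space UNIV)
            = (\<integral>\<^sup>+m. (\<Sum>x\<in>UNIV. \<Sum>y\<in>UNIV. ennreal (px x q * py y q / pq q ^ 2) * ennreal (F x m * G y m)) \<partial>count_space UNIV)"
          by (simp add: ennreal_mult'[symmetric] F G f_def g_def sum_product sum_divide_distrib mult_ac sum_nonneg)
        also have "\<dots> = (\<Sum>x\<in>UNIV. \<Sum>y\<in>UNIV. ennreal (px x q * py y q / pq q ^ 2) * (\<integral>\<^sup>+m. ennreal (F x m * G y m) \<partial>count_space UNIV))"
          by (simp add: nn_integral_sum nn_integral_cmult)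
        also have "\<dots> \<le> (\<Sum>x\<in>UNIV. \<Sum>y\<in>UNIV. ennreal (px x q * py y q / pq q ^ 2) * 1)"
          by (intro sum_mono mult_left_mono mass) auto
        also have "\<dots> = ennreal ((\<Sum>x\<in>UNIV. px x q) * (\<Sum>y\<in>UNIV. py y q) / pq q ^ 2)"
          by (simp add: sum_product sum_divide_distrib sum_nonneg)
        also have "\<dots> \<le> 1"
          by (simp add: slice power2_eq_square)
        finally show "(\<integral>\<^sup>+m. ennreal (f q m * g q m / pq q ^ 2) \<partial>count_space UNIV) \<le> 1" .
      qed auto
      then show ?thesis by (simp add: 3 u_def)
    qed
  next
    fix i \<omega> show "0 \<le> u i \<omega>" by (auto simp: u_def F G)
  next
    fix \<omega> assume \<omega>: "\<omega> \<in> set_pmf p"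
    note pos = level_prob_pos[OF \<omega>]
    have "0 < level_prob p (\<lambda>\<omega>. (X \<omega>, Y \<omega>, Q \<omega>)) \<omega> * F (X \<omega>) (M \<omega>) * G (Y \<omega>) (M \<omega>)"
      unfolding law[OF \<omega>, symmetric] by (rule pos)
    then have FG: "0 < F (X \<omega>) (M \<omega>)" "0 < G (Y \<omega>) (M \<omega>)"
      using F[of "X \<omega>" "M \<omega>"] G[of "Y \<omega>" "M \<omega>"] by (auto simp: zero_less_mult_iff)
    have pq: "px (X \<omega>) (Q \<omega>) = level_prob p (\<lambda>\<omega>. (X \<omega>, Q \<omega>)) \<omega>"
      "py (Y \<omega>) (Q \<omega>) = level_prob p (\<lambda>\<omega>. (Y \<omega>, Q \<omega>)) \<omega>" "pq (Q \<omega>) = level_prob p Q \<omega>"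
      by (simp_all add: px_def py_def pq_def level_prob_eq_pmf)
    have "px (X \<omega>) (Q \<omega>) * F (X \<omega>) (M \<omega>) \<le> f (Q \<omega>) (M \<omega>)"
      unfolding f_def by (rule member_le_sum) (auto simp: F)
    moreover have "0 < px (X \<omega>) (Q \<omega>) * F (X \<omega>) (M \<omega>)"
      by (simp add: pq FG pos)
    ultimately have f: "0 < f (Q \<omega>) (M \<omega>)"
      by (rule less_le_trans[rotated])
    have "py (Y \<omega>) (Q \<omega>) * G (Y \<omega>) (M \<omega>) \<le> g (Q \<omega>) (M \<omega>)"
      unfolding g_def by (rule member_le_sum) (auto simp: G)
    moreover have "0 < py (Y \<omega>) (Q \<omega>) * G (Y \<omega>) (M \<omega>)"
      by (simp add: pq FG pos)
    ultimately have g: "0 < g (Q \<omega>) (M \<omega>)"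
      by (rule less_le_trans[rotated])
    show "0 < u i \<omega>" for i
      unfolding u_def pq by (auto intro!: mult_pos_pos divide_pos_pos zero_less_power f g FG pos)
    have perm: "level_prob p (\<lambda>\<omega>. (M \<omega>, Q \<omega>)) \<omega> = level_prob p (\<lambda>\<omega>. (Q \<omega>, M \<omega>)) \<omega>"
      "level_prob p (\<lambda>\<omega>. (Y \<omega>, X \<omega>, Q \<omega>)) \<omega> = level_prob p (\<lambda>\<omega>. (X \<omega>, Y \<omega>, Q \<omega>)) \<omega>"
      "level_prob p (\<lambda>\<omega>. (Y \<omega>, X \<omega>, Q \<omega>, M \<omega>)) \<omega> = level_prob p (\<lambda>\<omega>. (X \<omega>, Y \<omega>, Q \<omega>, M \<omega>)) \<omega>"
      by (auto intro!: level_prob_cong)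
    \<comment> \<open>The letters stand for level probabilities, with the joint one already replaced
      by \<open>h * F' * G'\<close>. On the right the normalisers \<open>f'\<close> and
      \<open>g'\<close> cancel, on the left \<open>h\<close> does.\<close>
    have logs: "(- log 2 (d / c) - - log 2 (h * F' * G' / e)) - (- log 2 (b / k) - - log 2 (h / a))
        = log 2 (a * F' / f' * c / e) + (log 2 (b * G' / g' * c / d) + log 2 (f' * g' / k ^ 2 * k / c))"
      if "0 < a" "0 < b" "0 < c" "0 < d" "0 < e" "0 < h" "0 < k" "0 < F'" "0 < G'" "0 < f'" "0 < g'"
      for a b c d e h k F' G' f' g' :: real
      using that by (simp add: log_divide log_mult log_nat_power)
    show "?D \<omega> = (\<Sum>i\<in>{0, 1, 2}. log 2 (u i \<omega>))"
      unfolding surprisal_def perm law[OF \<omega>] logs[OF pos pos pos pos pos pos pos FG f g]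
      by (simp add: u_def pq perm)
  qed simp
  then show ?thesis
    by (simp add: ent_def Bochner_Integration.integral_diff surprisal_integrable[OF fin])
qed

section \<open>Leakage and residual information\<close>

lemma cond_indep_commute: "cond_indep p f g h \<Longrightarrow> cond_indep p g f h"
proof -
  have "level_prob p (\<lambda>\<omega>. (g \<omega>, f \<omega>, h \<omega>)) \<omega> = level_prob p (\<lambda>\<omega>. (f \<omega>, g \<omega>, h \<omega>)) \<omega>" for \<omega>
    by (rule level_prob_cong) auto
  then show "cond_indep p f g h \<Longrightarrow> cond_indep p g f h"
    by (simp add: cond_indep_def mult.commute)
qed

text \<open>In other terms, I(X;QM|Y) is at most I(X;Q|Y) + I(X;M|Y). By the conditional
  independence, the pointwise defect is the pointwise information between \<open>Q\<close> and
  \<open>M\<close> given \<open>Y\<close>. Gibbs' inequality is applied to it directly because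
  \<open>Q\<close> and \<open>M\<close> may have infinite entropy.\<close>

lemma ent_submodular_cond_indep:
  assumes fin: "fin_ent p X" and ci: "cond_indep p Q M (\<lambda>\<omega>. (X \<omega>, Y \<omega>))"
  shows "ent p X (\<lambda>\<omega>. (Q \<omega>, Y \<omega>)) + ent p X (\<lambda>\<omega>. (M \<omega>, Y \<omega>))
    \<le> ent p X Y + ent p X (\<lambda>\<omega>. (Q \<omega>, M \<omega>, Y \<omega>))"
proof -
  let ?D = "\<lambda>\<omega>. (surprisal p X (\<lambda>\<omega>. (Q \<omega>, Y \<omega>)) \<omega> + surprisal p X (\<lambda>\<omega>. (M \<omega>, Y \<omega>)) \<omega>) -
    (surprisal p X Y \<omega> + surprisal p X (\<lambda>\<omega>. (Q \<omega>, M \<omega>, Y \<omega>)) \<omega>)"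
  have "measure_pmf.expectation p ?D \<le> 0"
  proof (rule gibbs_inequality[where I = "{()}", OF _ _ _ _ _ nn_cond_ratio[of p Q Y M]])
    show "integrable (measure_pmf p) ?D"
      by (intro Bochner_Integration.integrable_diff Bochner_Integration.integrable_add surprisal_integrable fin)
    fix \<omega> assume \<omega>: "\<omega> \<in> set_pmf p"
    note pos = level_prob_pos[OF \<omega>]
    have perm: "level_prob p (\<lambda>\<omega>. (X \<omega>, Q \<omega>, Y \<omega>)) \<omega> = level_prob p (\<lambda>\<omega>. (Q \<omega>, X \<omega>, Y \<omega>)) \<omega>"
      "level_prob p (\<lambda>\<omega>. (X \<omega>, M \<omega>, Y \<omega>)) \<omega> = level_prob p (\<lambda>\<omega>. (M \<omega>, X \<omega>, Y \<omega>)) \<omega>"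
      "level_prob p (\<lambda>\<omega>. (X \<omega>, Q \<omega>, M \<omega>, Y \<omega>)) \<omega> = level_prob p (\<lambda>\<omega>. (Q \<omega>, M \<omega>, X \<omega>, Y \<omega>)) \<omega>"
      by (auto intro!: level_prob_cong)
    \<comment> \<open>The last premise is the conditional independence; it removes all the level
      probabilities that involve \<open>X\<close>.\<close>
    have logs: "(- log 2 (a / b) + - log 2 (c / d)) - (- log 2 (e / f) + - log 2 (g / h)) = log 2 (b * d / (f * h))"
      if "0 < a" "0 < b" "0 < c" "0 < d" "0 < e" "0 < f" "0 < g" "0 < h" "g * e = a * c"
      for a b c d e f g h :: real
    proof -
      have "log 2 g + log 2 e = log 2 a + log 2 c"
        using that log_mult_pos[of g e 2] log_mult_pos[of a c 2] by simp
      then show ?thesis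
        using that by (simp add: log_divide log_mult)
    qed
    show "?D \<omega> = (\<Sum>i\<in>{()}. log 2 (level_prob p (\<lambda>\<omega>. (Q \<omega>, Y \<omega>)) \<omega> * level_prob p (\<lambda>\<omega>. (M \<omega>, Y \<omega>)) \<omega> /
        (level_prob p Y \<omega> * level_prob p (\<lambda>\<omega>. (Q \<omega>, M \<omega>, Y \<omega>)) \<omega>)))"
      using ci[unfolded cond_indep_def, rule_format, OF \<omega>]
      unfolding surprisal_def perm by (subst logs[OF pos pos pos pos pos pos pos pos]) auto
  qed (auto simp: level_prob_pos intro!: mult_pos_pos divide_pos_pos)
  then show ?thesis
    by (simp add: ent_def Bochner_Integration.integral_diff Bochner_Integration.integral_add surprisal_integrable[OF fin])
qed

text \<open>The left side is I(AX;QM|BY). By the chain rule its first term is H(AB|XY) + H(X|Y) -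
  H(B|Y). In the second term \<open>A\<close> is dropped by nonnegativity and \<open>B\<close> by
  \<open>XB\<close>, which leaves H(X|QMY); submodularity then separates \<open>Q\<close> from
  \<open>M\<close>.\<close>

lemma leakage_bound:
  assumes fin: "fin_ent p X" "fin_ent p A" "fin_ent p B"
    and QM: "cond_indep p Q M (\<lambda>\<omega>. (X \<omega>, Y \<omega>))"
    and XB: "cond_indep p X B (\<lambda>\<omega>. (Q \<omega>, M \<omega>, Y \<omega>))"
  shows "ent p (\<lambda>\<omega>. (A \<omega>, X \<omega>)) (\<lambda>\<omega>. (B \<omega>, Y \<omega>)) - ent p (\<lambda>\<omega>. (A \<omega>, X \<omega>)) (\<lambda>\<omega>. ((Q \<omega>, M \<omega>), B \<omega>, Y \<omega>))
    \<le> (ent p X Y - ent p X (\<lambda>\<omega>. (Q \<omega>, Y \<omega>))) + (ent p X Y - ent p X (\<lambda>\<omega>. (M \<omega>, Y \<omega>)))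
      - ent p B Y + ent p (\<lambda>\<omega>. (A \<omega>, B \<omega>)) (\<lambda>\<omega>. (X \<omega>, Y \<omega>))"
proof -
  have "ent p (\<lambda>\<omega>. (A \<omega>, X \<omega>)) (\<lambda>\<omega>. (B \<omega>, Y \<omega>)) + ent p B Y = ent p (\<lambda>\<omega>. ((A \<omega>, X \<omega>), B \<omega>)) Y"
    by (rule ent_chain[symmetric]) (intro fin fin_ent_pair)+
  also have "\<dots> = ent p (\<lambda>\<omega>. ((A \<omega>, B \<omega>), X \<omega>)) Y"
    by (rule ent_cong) auto
  also have "\<dots> = ent p (\<lambda>\<omega>. (A \<omega>, B \<omega>)) (\<lambda>\<omega>. (X \<omega>, Y \<omega>)) + ent p X Y"
    by (rule ent_chain) (intro fin fin_ent_pair)+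
  finally have 1: "ent p (\<lambda>\<omega>. (A \<omega>, X \<omega>)) (\<lambda>\<omega>. (B \<omega>, Y \<omega>)) + ent p B Y
    = ent p (\<lambda>\<omega>. (A \<omega>, B \<omega>)) (\<lambda>\<omega>. (X \<omega>, Y \<omega>)) + ent p X Y" .
  have "ent p X (\<lambda>\<omega>. (Q \<omega>, M \<omega>, Y \<omega>)) = ent p X (\<lambda>\<omega>. (B \<omega>, Q \<omega>, M \<omega>, Y \<omega>))"
    by (rule ent_cond_indep[OF XB, symmetric])
  also have "\<dots> = ent p X (\<lambda>\<omega>. ((Q \<omega>, M \<omega>), B \<omega>, Y \<omega>))"
    by (rule ent_cong) auto
  also have "\<dots> \<le> ent p (\<lambda>\<omega>. (A \<omega>, X \<omega>)) (\<lambda>\<omega>. ((Q \<omega>, M \<omega>), B \<omega>, Y \<omega>))"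
    using ent_nonneg[of p A] by (subst ent_chain) (simp_all add: fin)
  finally show ?thesis
    using 1 ent_submodular_cond_indep[OF fin(1) QM] by linarith
qed

text \<open>\<open>A\<close> disappears from the conditioning by its Markov chain. Splitting off
  \<open>B\<close> leaves its entropy given \<open>(Y, Q, M)\<close> and given
  \<open>(Y, X, Q, M)\<close>; these are equal, so they cancel.\<close>

lemma mutual_info_outputs:
  assumes fin: "fin_ent p Y" "fin_ent p B"
    and A: "cond_indep p A (\<lambda>\<omega>. (B \<omega>, Y \<omega>)) (\<lambda>\<omega>. (X \<omega>, Q \<omega>, M \<omega>))"
    and B: "cond_indep p X B (\<lambda>\<omega>. (Q \<omega>, M \<omega>, Y \<omega>))"
  shows "ent p (\<lambda>\<omega>. (B \<omega>, Y \<omega>)) (\<lambda>\<omega>. (Q \<omega>, M \<omega>)) - ent p (\<lambda>\<omega>. (B \<omega>, Y \<omega>)) (\<lambda>\<omega>. ((A \<omega>, X \<omega>), Q \<omega>, M \<omega>))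
    = ent p Y (\<lambda>\<omega>. (Q \<omega>, M \<omega>)) - ent p Y (\<lambda>\<omega>. (X \<omega>, Q \<omega>, M \<omega>))"
proof -
  have "ent p (\<lambda>\<omega>. (B \<omega>, Y \<omega>)) (\<lambda>\<omega>. ((A \<omega>, X \<omega>), Q \<omega>, M \<omega>)) = ent p (\<lambda>\<omega>. (B \<omega>, Y \<omega>)) (\<lambda>\<omega>. (A \<omega>, X \<omega>, Q \<omega>, M \<omega>))"
    by (rule ent_cong) auto
  also have "\<dots> = ent p (\<lambda>\<omega>. (B \<omega>, Y \<omega>)) (\<lambda>\<omega>. (X \<omega>, Q \<omega>, M \<omega>))"
    by (rule ent_cond_indep[OF cond_indep_commute[OF A]])
  also have "\<dots> = ent p B (\<lambda>\<omega>. (Y \<omega>, X \<omega>, Q \<omega>, M \<omega>)) + ent p Y (\<lambda>\<omega>. (X \<omega>, Q \<omega>, M \<omega>))"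
    by (rule ent_chain) (rule fin)+
  also have "ent p B (\<lambda>\<omega>. (Y \<omega>, X \<omega>, Q \<omega>, M \<omega>)) = ent p B (\<lambda>\<omega>. (X \<omega>, Q \<omega>, M \<omega>, Y \<omega>))"
    by (rule ent_cong) auto
  also have "\<dots> = ent p B (\<lambda>\<omega>. (Q \<omega>, M \<omega>, Y \<omega>))"
    by (rule ent_cond_indep[OF cond_indep_commute[OF B]])
  also have "\<dots> = ent p B (\<lambda>\<omega>. (Y \<omega>, Q \<omega>, M \<omega>))"
    by (rule ent_cong) auto
  finally show ?thesis
    using ent_chain[OF fin(2,1), of "\<lambda>\<omega>. (Q \<omega>, M \<omega>)"] by simp
qed

section \<open>Joint laws\<close>

lemma ennreal_pmf_bind_Pair:
  "ennreal (pmf (bind_pmf p (\<lambda>x. map_pmf (Pair x) (f x))) (x, y)) = ennreal (pmf p x) * ennreal (pmf (f x) y)"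
proof -
  have "pmf (map_pmf (Pair z) (f z)) (x, y) = indicator {x} z * pmf (f x) y" for z
    by (cases "z = x") (auto simp: pmf_map vimage_def measure_pmf_single)
  then have "ennreal (pmf (bind_pmf p (\<lambda>x. map_pmf (Pair x) (f x))) (x, y))
      = (\<integral>\<^sup>+z. ennreal (pmf (f x) y) * indicator {x} z \<partial>measure_pmf p)"
    unfolding ennreal_pmf_bind by (intro nn_integral_cong) (auto simp: indicator_def)
  also have "\<dots> = ennreal (pmf p x) * ennreal (pmf (f x) y)"
    by (simp add: emeasure_pmf_single mult.commute)
  finally show ?thesis .
qed

lemma pmf_bind_Pair: "pmf (bind_pmf p (\<lambda>x. map_pmf (Pair x) (f x))) (x, y) = pmf p x * pmf (f x) y"
  using ennreal_pmf_bind_Pair[of p f x y] by (simp add: ennreal_mult'[symmetric])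

text \<open>The channel is the conditional law of the third coordinate given the first two, taken
  from \<open>cond_pmf\<close>. It turns a joint law built by other means into the form that
  \<open>tension\<close> quantifies over.\<close>

lemma extend_law_disintegration:
  fixes W :: "('u \<times> 'v \<times> nat) pmf"
  obtains K where "extend_law (map_pmf (\<lambda>(u, v, k). (u, v)) W) K = W"
proof
  let ?uv = "\<lambda>(u :: 'u, v :: 'v, k :: nat). (u, v)" and ?k = "\<lambda>(u :: 'u, v :: 'v, k :: nat). k"
  let ?C = "\<lambda>z. cond_pmf W {\<omega>. ?uv \<omega> = z}"
  have "extend_law (map_pmf ?uv W) (\<lambda>u v. map_pmf ?k (?C (u, v)))
      = bind_pmf (map_pmf ?uv W) (\<lambda>z. map_pmf (\<lambda>\<omega>. (fst z, snd z, ?k \<omega>)) (?C z))"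
    by (simp add: extend_law_def split_beta' map_pmf_def bind_assoc_pmf bind_return_pmf)
  also have "\<dots> = bind_pmf (map_pmf ?uv W) ?C"
  proof (rule bind_pmf_cong[OF refl])
    fix z assume "z \<in> set_pmf (map_pmf ?uv W)"
    then have "set_pmf W \<inter> {\<omega>. ?uv \<omega> = z} \<noteq> {}" by auto
    then have "map_pmf (\<lambda>\<omega>. (fst z, snd z, ?k \<omega>)) (?C z) = map_pmf (\<lambda>\<omega>. \<omega>) (?C z)"
      by (intro map_pmf_cong refl) (auto simp: set_cond_pmf)
    then show "map_pmf (\<lambda>\<omega>. (fst z, snd z, ?k \<omega>)) (?C z) = ?C z"
      by simp
  qed
  also have "\<dots> = W"
  proof (rule bind_cond_pmf_cancel)
    fix z \<omega> assume "?uv \<omega> = z"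
    have "{z'. ?uv \<omega> = z'} = {z}" using \<open>?uv \<omega> = z\<close> by auto
    then show "measure_pmf.prob W {\<omega>. ?uv \<omega> = z} = measure_pmf.prob (map_pmf ?uv W) {z'. ?uv \<omega> = z'}"
      by (simp add: vimage_def)
  qed auto
  finally show "extend_law (map_pmf ?uv W) (\<lambda>u v. map_pmf ?k (?C (u, v))) = W" .
qed

section \<open>Transcripts of protocols\<close>

text \<open>The factor of the probability of a transcript that depends on the input and coins of
  party 1; even positions are the messages of party 1.\<close>

definition msgs1_prob :: "('x, 'y, 'a, 'b) protocol \<Rightarrow> 'x \<Rightarrow> nat \<Rightarrow> bool list list \<Rightarrow> real" where
  "msgs1_prob P x r ms = (\<Prod>i<length ms. if even i then pmf (msg1 P x r (take i ms)) (ms ! i) else 1)"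

definition msgs2_prob :: "('x, 'y, 'a, 'b) protocol \<Rightarrow> 'y \<Rightarrow> nat \<Rightarrow> bool list list \<Rightarrow> real" where
  "msgs2_prob P y r ms = (\<Prod>i<length ms. if even i then 1 else pmf (msg2 P y r (take i ms)) (ms ! i))"

lemma msgs1_prob_nonneg: "0 \<le> msgs1_prob P x r ms" and msgs2_prob_nonneg: "0 \<le> msgs2_prob P y r ms"
  by (auto simp: msgs1_prob_def msgs2_prob_def intro!: prod_nonneg)

lemma msgs1_prob_le_1: "msgs1_prob P x r ms \<le> 1" and msgs2_prob_le_1: "msgs2_prob P y r ms \<le> 1"
  by (auto simp: msgs1_prob_def msgs2_prob_def pmf_le_1 intro!: prod_le_1)

text \<open>The rectangle property of protocols: each message is drawn from the view of one party,
  so its probability joins one of the two factors.\<close>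

lemma pmf_transcript:
  "pmf (transcript P x r1 y r2 n) ms = (if length ms = n then msgs1_prob P x r1 ms * msgs2_prob P y r2 ms else 0)"
proof (induction n arbitrary: ms)
  case 0
  then show ?case by (auto simp: msgs1_prob_def msgs2_prob_def)
next
  case (Suc n)
  let ?T = "transcript P x r1 y r2 n"
  let ?msg = "\<lambda>ms. if even n then msg1 P x r1 ms else msg2 P y r2 ms"
  have eq: "transcript P x r1 y r2 (Suc n) = map_pmf (\<lambda>(ms, m). ms @ [m]) (bind_pmf ?T (\<lambda>ms. map_pmf (Pair ms) (?msg ms)))"
    by (simp add: map_pmf_def bind_assoc_pmf bind_return_pmf)
  show ?case
  proof (cases ms rule: rev_cases)
    case Nil
    then show ?thesis unfolding eq by (auto simp: pmf_eq_0_set_pmf)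
  next
    case (snoc ms' m)
    have "pmf (transcript P x r1 y r2 (Suc n)) ms = pmf ?T ms' * pmf (?msg ms') m"
      unfolding eq snoc
      using pmf_map_inj'[of "\<lambda>(ms :: bool list list, m). ms @ [m]" _ "(ms', m)"]
      by (simp add: inj_def pmf_bind_Pair)
    moreover have "msgs1_prob P x r1 ms = msgs1_prob P x r1 ms' * (if even (length ms') then pmf (msg1 P x r1 ms') m else 1)"
      by (simp add: msgs1_prob_def snoc nth_append cong: if_cong)
    moreover have "msgs2_prob P y r2 ms = msgs2_prob P y r2 ms' * (if even (length ms') then 1 else pmf (msg2 P y r2 ms') m)"
      by (simp add: msgs2_prob_def snoc nth_append cong: if_cong)
    ultimately show ?thesis
      by (auto simp: snoc Suc.IH)
  qed
qed

section \<open>Law of the transcript and the outputs given the inputs\<close>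

definition conversation ::
  "('x, 'y, 'c, 'd) protocol \<Rightarrow> ('x \<Rightarrow> nat \<Rightarrow> bool list list \<Rightarrow> 'a pmf) \<Rightarrow>
    ('y \<Rightarrow> nat \<Rightarrow> bool list list \<Rightarrow> 'b pmf) \<Rightarrow> 'x \<Rightarrow> 'y \<Rightarrow> (bool list list \<times> 'a \<times> 'b) pmf" where
  "conversation P o1 o2 x y = bind_pmf (coins1 P) (\<lambda>r1. bind_pmf (coins2 P) (\<lambda>r2.
     bind_pmf (transcript P x r1 y r2 (rounds P)) (\<lambda>ms.
       map_pmf (Pair ms) (pair_pmf (o1 x r1 ms) (o2 y r2 ms)))))"

text \<open>The private coins are integrated out. The check of the transcript length sits in this
  factor only, since the product has to contain it just once.\<close>

definition party1_likelihood where
  "party1_likelihood P o1 x m a = (\<integral>\<^sup>+r. ennreal ((if length m = rounds P then msgs1_prob P x r m else 0) *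
     pmf (o1 x r m) a) \<partial>measure_pmf (coins1 P))"

definition party2_likelihood where
  "party2_likelihood P o2 y m b = (\<integral>\<^sup>+r. ennreal (msgs2_prob P y r m * pmf (o2 y r m) b) \<partial>measure_pmf (coins2 P))"

text \<open>The coins of the two parties are independent, so averaging over both keeps the product
  form of \<open>pmf_transcript\<close>.\<close>

lemma pmf_conversation:
  "ennreal (pmf (conversation P o1 o2 x y) (m, a, b)) = party1_likelihood P o1 x m a * party2_likelihood P o2 y m b"
proof -
  have "ennreal (pmf (conversation P o1 o2 x y) (m, a, b)) =
    (\<integral>\<^sup>+r1. \<integral>\<^sup>+r2. ennreal ((if length m = rounds P then msgs1_prob P x r1 m else 0) * pmf (o1 x r1 m) a) *
      ennreal (msgs2_prob P y r2 m * pmf (o2 y r2 m) b) \<partial>measure_pmf (coins2 P) \<partial>measure_pmf (coins1 P))"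
    unfolding conversation_def ennreal_pmf_bind pmf_bind_Pair pmf_pair pmf_transcript
    by (intro nn_integral_cong) (simp add: ennreal_mult'[symmetric] msgs1_prob_nonneg mult_ac)
  also have "\<dots> = party1_likelihood P o1 x m a * party2_likelihood P o2 y m b"
    by (simp add: party1_likelihood_def party2_likelihood_def nn_integral_cmult nn_integral_multc)
  finally show ?thesis .
qed

lemma party1_likelihood_le_1: "party1_likelihood P o1 x m a \<le> 1"
proof -
  have "party1_likelihood P o1 x m a \<le> (\<integral>\<^sup>+r. 1 \<partial>measure_pmf (coins1 P))"
    unfolding party1_likelihood_def
    by (intro nn_integral_mono) (auto intro!: mult_le_one simp: msgs1_prob_le_1 msgs1_prob_nonneg pmf_le_1)
  then show ?thesis by simp
qed

lemma party2_likelihood_le_1: "party2_likelihood P o2 y m b \<le> 1"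
proof -
  have "party2_likelihood P o2 y m b \<le> (\<integral>\<^sup>+r. 1 \<partial>measure_pmf (coins2 P))"
    unfolding party2_likelihood_def
    by (intro nn_integral_mono) (auto intro!: mult_le_one simp: msgs2_prob_le_1 msgs2_prob_nonneg pmf_le_1)
  then show ?thesis by simp
qed

lemma map_conversation:
  "map_pmf (apsnd (map_prod g h)) (conversation P o1 o2 x y)
    = conversation P (\<lambda>x r m. map_pmf g (o1 x r m)) (\<lambda>y r m. map_pmf h (o2 y r m)) x y"
  by (simp add: conversation_def map_bind_pmf map_pmf_comp map_pair[symmetric] split_beta' map_prod_def)

text \<open>Given the inputs, \<open>K\<close> and \<open>L\<close> are sampled independently.
  \<open>K\<close> takes \<open>y\<close> before \<open>x\<close> because it comes from a channel
  for the pair (Y, X).\<close>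

definition joint_law ::
  "('x \<times> 'y) pmf \<Rightarrow> ('y \<Rightarrow> 'x \<Rightarrow> 'q pmf) \<Rightarrow> ('x \<Rightarrow> 'y \<Rightarrow> 'c pmf) \<Rightarrow> (('x \<times> 'y) \<times> 'q \<times> 'c) pmf" where
  "joint_law \<mu> K L = bind_pmf \<mu> (\<lambda>z. map_pmf (Pair z) (pair_pmf (K (snd z) (fst z)) (L (fst z) (snd z))))"

lemma pmf_joint_law:
  "pmf (joint_law \<mu> K L) ((x, y), q, c) = pmf \<mu> (x, y) * (pmf (K y x) q * pmf (L x y) c)"
  by (simp add: joint_law_def pmf_bind_Pair pmf_pair)

lemma map_joint_law:
  "map_pmf (\<lambda>(z, q, c). (z, q, g c)) (joint_law \<mu> K L) = joint_law \<mu> K (\<lambda>x y. map_pmf g (L x y))"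
  by (simp add: joint_law_def map_bind_pmf map_pmf_comp pair_map_pmf2 split_beta' apsnd_def map_prod_def)

text \<open>With \<open>g\<close> or \<open>h\<close> constantly \<open>()\<close> an output is
  erased, so this one formula provides every marginal in factored form. This is why
  \<open>conversation\<close> takes the output rules as parameters.\<close>

lemma map_joint_law_conversation:
  "ennreal (pmf (map_pmf (\<lambda>(z, q, m, a, b). (z, q, m, g a, h b)) (joint_law \<mu> K (conversation P o1 o2)))
      ((x, y), q, m, a, b))
    = ennreal (pmf \<mu> (x, y) * pmf (K y x) q) *
      (party1_likelihood P (\<lambda>x r m. map_pmf g (o1 x r m)) x m a * party2_likelihood P (\<lambda>y r m. map_pmf h (o2 y r m)) y m b)"
proof -
  have eq: "(\<lambda>(z, q, m, a, b). (z, q, m, g a, h b)) = (\<lambda>(z, q, c). (z, q, apsnd (map_prod g h) c))"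
    by auto
  show ?thesis
    unfolding eq map_joint_law map_conversation pmf_joint_law
    by (simp add: ennreal_mult' pmf_conversation mult_ac)
qed

section \<open>Markov chains of the joint law\<close>

definition rvX where "rvX \<omega> = (case \<omega> of ((x, y), q, m, a, b) \<Rightarrow> x)"
definition rvY where "rvY \<omega> = (case \<omega> of ((x, y), q, m, a, b) \<Rightarrow> y)"
definition rvQ where "rvQ \<omega> = (case \<omega> of ((x, y), q, m, a, b) \<Rightarrow> q)"
definition rvM where "rvM \<omega> = (case \<omega> of ((x, y), q, m, a, b) \<Rightarrow> m)"
definition rvA where "rvA \<omega> = (case \<omega> of ((x, y), q, m, a, b) \<Rightarrow> a)"
definition rvB where "rvB \<omega> = (case \<omega> of ((x, y), q, m, a, b) \<Rightarrow> b)"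

lemmas rv_defs = rvX_def rvY_def rvQ_def rvM_def rvA_def rvB_def

text \<open>For fixed \<open>x\<close>, \<open>q\<close>, \<open>m\<close> the value
  \<open>a\<close> enters only through the likelihood of party 1, and \<open>y\<close> and
  \<open>b\<close> only through the remaining factors.\<close>

lemma cond_indep_A_BY:
  fixes \<mu> :: "('x \<times> 'y) pmf" and K :: "'y \<Rightarrow> 'x \<Rightarrow> 'q pmf"
    and o1 :: "'x \<Rightarrow> nat \<Rightarrow> bool list list \<Rightarrow> 'a pmf" and o2 :: "'y \<Rightarrow> nat \<Rightarrow> bool list list \<Rightarrow> 'b pmf"
  shows "cond_indep (joint_law \<mu> K (conversation P o1 o2)) rvA (\<lambda>\<omega>. (rvB \<omega>, rvY \<omega>)) (\<lambda>\<omega>. (rvX \<omega>, rvQ \<omega>, rvM \<omega>))"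
    (is "cond_indep ?W _ _ _")
proof (rule cond_indep_factor)
  fix a and by' :: "'b \<times> 'y" and xqm :: "'x \<times> 'q \<times> bool list list"
  obtain b y x q m where z: "by' = (b, y)" "xqm = (x, q, m)" by (metis prod.exhaust)
  have "pmf (map_pmf (\<lambda>\<omega>. (rvA \<omega>, (rvB \<omega>, rvY \<omega>), rvX \<omega>, rvQ \<omega>, rvM \<omega>)) ?W) (a, by', xqm)
      = pmf (map_pmf (\<lambda>(z, q, m, a, b). (z, q, m, a, b)) ?W) ((x, y), q, m, a, b)"
    unfolding pmf_map by (rule arg_cong[where f = "measure_pmf.prob ?W"]) (auto simp: z rv_defs)
  then show "ennreal (pmf (map_pmf (\<lambda>\<omega>. (rvA \<omega>, (rvB \<omega>, rvY \<omega>), rvX \<omega>, rvQ \<omega>, rvM \<omega>)) ?W) (a, by', xqm))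
      = (case xqm of (x, q, m) \<Rightarrow> party1_likelihood P o1 x m a) *
        (case (by', xqm) of ((b, y), (x, q, m)) \<Rightarrow> ennreal (pmf \<mu> (x, y) * pmf (K y x) q) * party2_likelihood P o2 y m b)"
    using map_joint_law_conversation[of "\<lambda>a. a" "\<lambda>b. b" \<mu> K P o1 o2 x y q m a b]
    by (simp add: z mult_ac)
qed

text \<open>With \<open>A\<close> erased and \<open>q\<close>, \<open>m\<close>, \<open>y\<close>
  fixed, \<open>b\<close> occurs only in the likelihood of party 2, which does not involve
  \<open>x\<close>.\<close>

lemma cond_indep_X_B:
  fixes \<mu> :: "('x \<times> 'y) pmf" and K :: "'y \<Rightarrow> 'x \<Rightarrow> 'q pmf"
    and o1 :: "'x \<Rightarrow> nat \<Rightarrow> bool list list \<Rightarrow> 'a pmf" and o2 :: "'y \<Rightarrow> nat \<Rightarrow> bool list list \<Rightarrow> 'b pmf"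
  shows "cond_indep (joint_law \<mu> K (conversation P o1 o2)) rvX rvB (\<lambda>\<omega>. (rvQ \<omega>, rvM \<omega>, rvY \<omega>))"
    (is "cond_indep ?W _ _ _")
proof (rule cond_indep_factor)
  fix x b and qmy :: "'q \<times> bool list list \<times> 'y"
  obtain q m y where z: "qmy = (q, m, y)" by (metis prod.exhaust)
  have "pmf (map_pmf (\<lambda>\<omega>. (rvX \<omega>, rvB \<omega>, rvQ \<omega>, rvM \<omega>, rvY \<omega>)) ?W) (x, b, qmy)
      = pmf (map_pmf (\<lambda>(z, q, m, a, b). (z, q, m, (), b)) ?W) ((x, y), q, m, (), b)"
    unfolding pmf_map by (rule arg_cong[where f = "measure_pmf.prob ?W"]) (auto simp: z rv_defs)
  then show "ennreal (pmf (map_pmf (\<lambda>\<omega>. (rvX \<omega>, rvB \<omega>, rvQ \<omega>, rvM \<omega>, rvY \<omega>)) ?W) (x, b, qmy))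
      = (case qmy of (q, m, y) \<Rightarrow> ennreal (pmf \<mu> (x, y) * pmf (K y x) q) * party1_likelihood P (\<lambda>x r m. return_pmf ()) x m ()) *
        (case qmy of (q, m, y) \<Rightarrow> party2_likelihood P o2 y m b)"
    using map_joint_law_conversation[of "\<lambda>a. ()" "\<lambda>b. b" \<mu> K P o1 o2 x y q m "()" b]
    by (simp add: z mult_ac)
qed

lemma cond_indep_Y_A:
  fixes \<mu> :: "('x \<times> 'y) pmf" and K :: "'y \<Rightarrow> 'x \<Rightarrow> 'q pmf"
    and o1 :: "'x \<Rightarrow> nat \<Rightarrow> bool list list \<Rightarrow> 'a pmf" and o2 :: "'y \<Rightarrow> nat \<Rightarrow> bool list list \<Rightarrow> 'b pmf"
  shows "cond_indep (joint_law \<mu> K (conversation P o1 o2)) rvY rvA (\<lambda>\<omega>. (rvQ \<omega>, rvM \<omega>, rvX \<omega>))"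
    (is "cond_indep ?W _ _ _")
proof (rule cond_indep_factor)
  fix y a and qmx :: "'q \<times> bool list list \<times> 'x"
  obtain q m x where z: "qmx = (q, m, x)" by (metis prod.exhaust)
  have "pmf (map_pmf (\<lambda>\<omega>. (rvY \<omega>, rvA \<omega>, rvQ \<omega>, rvM \<omega>, rvX \<omega>)) ?W) (y, a, qmx)
      = pmf (map_pmf (\<lambda>(z, q, m, a, b). (z, q, m, a, ())) ?W) ((x, y), q, m, a, ())"
    unfolding pmf_map by (rule arg_cong[where f = "measure_pmf.prob ?W"]) (auto simp: z rv_defs)
  then show "ennreal (pmf (map_pmf (\<lambda>\<omega>. (rvY \<omega>, rvA \<omega>, rvQ \<omega>, rvM \<omega>, rvX \<omega>)) ?W) (y, a, qmx))
      = (case qmx of (q, m, x) \<Rightarrow> ennreal (pmf \<mu> (x, y) * pmf (K y x) q) * party2_likelihood P (\<lambda>y r m. return_pmf ()) y m ()) *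
        (case qmx of (q, m, x) \<Rightarrow> party1_likelihood P o1 x m a)"
    using map_joint_law_conversation[of "\<lambda>a. a" "\<lambda>b. ()" \<mu> K P o1 o2 x y q m a "()"]
    by (simp add: z mult_ac)
qed

text \<open>Both outputs are erased; given the inputs, \<open>Q\<close> and the run are sampled
  independently.\<close>

lemma cond_indep_Q_M:
  fixes \<mu> :: "('x \<times> 'y) pmf" and K :: "'y \<Rightarrow> 'x \<Rightarrow> 'q pmf"
    and o1 :: "'x \<Rightarrow> nat \<Rightarrow> bool list list \<Rightarrow> 'a pmf" and o2 :: "'y \<Rightarrow> nat \<Rightarrow> bool list list \<Rightarrow> 'b pmf"
  shows "cond_indep (joint_law \<mu> K (conversation P o1 o2)) rvQ rvM (\<lambda>\<omega>. (rvX \<omega>, rvY \<omega>))"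
    (is "cond_indep ?W _ _ _")
proof (rule cond_indep_factor)
  fix q m and xy :: "'x \<times> 'y"
  obtain x y where z: "xy = (x, y)" by (metis prod.exhaust)
  have "pmf (map_pmf (\<lambda>\<omega>. (rvQ \<omega>, rvM \<omega>, rvX \<omega>, rvY \<omega>)) ?W) (q, m, xy)
      = pmf (map_pmf (\<lambda>(z, q, m, a, b). (z, q, m, (), ())) ?W) ((x, y), q, m, (), ())"
    unfolding pmf_map by (rule arg_cong[where f = "measure_pmf.prob ?W"]) (auto simp: z rv_defs)
  then show "ennreal (pmf (map_pmf (\<lambda>\<omega>. (rvQ \<omega>, rvM \<omega>, rvX \<omega>, rvY \<omega>)) ?W) (q, m, xy))
      = (case xy of (x, y) \<Rightarrow> ennreal (pmf \<mu> (x, y) * pmf (K y x) q)) *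
        (case xy of (x, y) \<Rightarrow> party1_likelihood P (\<lambda>x r m. return_pmf ()) x m () * party2_likelihood P (\<lambda>y r m. return_pmf ()) y m ())"
    using map_joint_law_conversation[of "\<lambda>a. ()" "\<lambda>b. ()" \<mu> K P o1 o2 x y q m "()" "()"]
    by (simp add: z)
qed

text \<open>\<open>mutual_info_factor_le\<close> applies with the two party likelihoods, outputs
  erased, as \<open>F\<close> and \<open>G\<close>.\<close>

lemma mutual_info_transcript_le:
  fixes \<mu> :: "('x::finite \<times> 'y::finite) pmf" and K P o1 o2
  defines "W \<equiv> joint_law \<mu> K (conversation P o1 o2)"
  shows "ent W rvY (\<lambda>\<omega>. (rvQ \<omega>, rvM \<omega>)) - ent W rvY (\<lambda>\<omega>. (rvX \<omega>, rvQ \<omega>, rvM \<omega>))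
    \<le> ent W rvY rvQ - ent W rvY (\<lambda>\<omega>. (rvX \<omega>, rvQ \<omega>))"
proof (rule mutual_info_factor_le)
  let ?F = "\<lambda>x m. party1_likelihood P (\<lambda>x r m. return_pmf ()) x m ()" and ?G = "\<lambda>y m. party2_likelihood P (\<lambda>y r m. return_pmf ()) y m ()"
  \<comment> \<open>The likelihoods are at most 1, so passing to real numbers by
    \<open>enn2real\<close> loses nothing.\<close>
  have fin: "?F x m < \<top>" "?G y m < \<top>" for x y m
    by (rule le_less_trans[OF party1_likelihood_le_1 ennreal_one_less_top] le_less_trans[OF party2_likelihood_le_1 ennreal_one_less_top])+
  have FG: "ennreal (enn2real (?F x m) * enn2real (?G y m))
      = ennreal (pmf (conversation P (\<lambda>x r m. return_pmf ()) (\<lambda>y r m. return_pmf ()) x y) (m, (), ()))" for x y m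
    unfolding pmf_conversation using fin(1)[of x m] fin(2)[of y m] by (simp add: ennreal_mult')
  \<comment> \<open>Summing over \<open>m\<close> leaves the law of the erased outputs, a single
    probability.\<close>
  show "(\<integral>\<^sup>+m. ennreal (enn2real (?F x m) * enn2real (?G y m)) \<partial>count_space UNIV) \<le> 1" for x y
    unfolding FG
    using nn_level_prob_slice[of fst snd "conversation P (\<lambda>x r m. return_pmf ()) (\<lambda>y r m. return_pmf ()) x y" "((), ())"]
    by (simp add: pmf_le_1)
  fix \<omega> assume "\<omega> \<in> set_pmf W"
  have "ennreal (pmf (map_pmf (\<lambda>\<omega>. (rvX \<omega>, rvY \<omega>, rvQ \<omega>, rvM \<omega>)) W) (x, y, q, m))
      = ennreal (pmf (map_pmf (\<lambda>\<omega>. (rvX \<omega>, rvY \<omega>, rvQ \<omega>)) W) (x, y, q) * enn2real (?F x m) * enn2real (?G y m))"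
    for x y q m
  proof -
    have "pmf (map_pmf (\<lambda>\<omega>. (rvX \<omega>, rvY \<omega>, rvQ \<omega>, rvM \<omega>)) W) (x, y, q, m)
        = pmf (map_pmf (\<lambda>(z, q, m, a, b). (z, q, m, (), ())) W) ((x, y), q, m, (), ())"
      unfolding pmf_map by (rule arg_cong[where f = "measure_pmf.prob W"]) (auto simp: rv_defs)
    moreover have "pmf (map_pmf (\<lambda>\<omega>. (rvX \<omega>, rvY \<omega>, rvQ \<omega>)) W) (x, y, q)
        = pmf (map_pmf (\<lambda>(z, q, c). (z, q, ())) W) ((x, y), q, ())"
      unfolding pmf_map by (rule arg_cong[where f = "measure_pmf.prob W"]) (auto simp: rv_defs)
    ultimately show ?thesis
      using map_joint_law_conversation[of "\<lambda>a. ()" "\<lambda>b. ()" \<mu> K P o1 o2 x y q m "()" "()"]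
      using fin(1)[of x m] fin(2)[of y m]
      by (simp add: W_def map_joint_law[where g = "\<lambda>_. ()"] pmf_joint_law ennreal_mult' mult_ac)
  qed
  then show "level_prob W (\<lambda>\<omega>. (rvX \<omega>, rvY \<omega>, rvQ \<omega>, rvM \<omega>)) \<omega>
      = level_prob W (\<lambda>\<omega>. (rvX \<omega>, rvY \<omega>, rvQ \<omega>)) \<omega> * enn2real (?F (rvX \<omega>) (rvM \<omega>)) * enn2real (?G (rvY \<omega>) (rvM \<omega>))"
    by (simp add: level_prob_eq_pmf)
qed auto

section \<open>Regions\<close>

lemma cond_mutual_info_map:
  fixes X :: "'p \<Rightarrow> 'a::countable" and Y :: "'p \<Rightarrow> 'b::countable" and Z :: "'p \<Rightarrow> 'c::countable"
  assumes "fin_ent p (\<lambda>\<omega>. X (\<phi> \<omega>))"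
  shows "cond_mutual_info (map_pmf \<phi> p) X Y Z
    = ent p (\<lambda>\<omega>. X (\<phi> \<omega>)) (\<lambda>\<omega>. Z (\<phi> \<omega>)) - ent p (\<lambda>\<omega>. X (\<phi> \<omega>)) (\<lambda>\<omega>. (Y (\<phi> \<omega>), Z (\<phi> \<omega>)))"
  using assms by (simp add: cond_mutual_info_eq_ent fin_ent_map ent_map)

text \<open>Projecting \<open>Q\<close> away makes the right side independent of \<open>K\<close>,
  so the same joint law can carry both the run and any given channel.\<close>

lemma run_protocol_eq_map_joint_law:
  "run_protocol P \<mu> = map_pmf (\<lambda>\<omega>. (rvX \<omega>, rvY \<omega>, rvM \<omega>, rvA \<omega>, rvB \<omega>))
     (joint_law \<mu> K (conversation P (out1 P) (out2 P)))"
  by (simp add: run_protocol_def joint_law_def conversation_def rv_defs split_beta' map_bind_pmf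
      bind_map_pmf map_pmf_def[symmetric] pair_pmf_def bind_assoc_pmf bind_return_pmf map_pmf_comp)

lemma extend_law_eq_map_joint_law:
  "extend_law (map_pmf prod.swap \<mu>) K = map_pmf (\<lambda>\<omega>. (rvY \<omega>, rvX \<omega>, rvQ \<omega>)) (joint_law \<mu> K L)"
  by (simp add: extend_law_def joint_law_def rv_defs split_beta' map_bind_pmf
      bind_map_pmf map_pmf_def[symmetric] pair_pmf_def bind_assoc_pmf bind_return_pmf map_pmf_comp)

text \<open>This is the membership that \<open>region_diff\<close> asks for, with the rates of the
  protocol reduced by the entropy differences and added to an arbitrary point of the tension region
  of the inputs.\<close>

lemma tension_shift:
  fixes p :: "('x::finite \<times> 'y::finite \<times> 'a::countable \<times> 'b::countable) pmf"
    and P :: "('x, 'y, 'a, 'b) protocol"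
  defines "X \<equiv> \<lambda>(x, y, a, b). x" and "Y \<equiv> \<lambda>(x, y, a, b). y"
    and "A \<equiv> \<lambda>(x, y, a, b). a" and "B \<equiv> \<lambda>(x, y, a, b). b"
  assumes fin: "fin_ent p A" "fin_ent p B"
    and P: "realizes P p" "IC12 P (input_law p) \<le> r1" "IC21 P (input_law p) \<le> r2"
    and s: "(s1, s2) \<in> tension c (map_pmf (\<lambda>(x, y, a, b). (y, x)) p)"
  shows "(s1 + (r1 - (ent p B Y - ent p (\<lambda>\<omega>. (A \<omega>, B \<omega>)) (\<lambda>\<omega>. (X \<omega>, Y \<omega>)))),
      s2 + (r2 - (ent p A X - ent p (\<lambda>\<omega>. (A \<omega>, B \<omega>)) (\<lambda>\<omega>. (X \<omega>, Y \<omega>)))))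
    \<in> tension c (map_pmf (\<lambda>(x, y, a, b). ((b, y), (a, x))) p)"
proof -
  let ?\<mu> = "input_law p"
  have swap: "map_pmf (\<lambda>(x, y, a, b). (y, x)) p = map_pmf prod.swap ?\<mu>"
    by (simp add: input_law_def map_pmf_comp split_beta')
  obtain K where K: "cond_mutual_info (extend_law (map_pmf prod.swap ?\<mu>) K) (\<lambda>(u, v, k). v) (\<lambda>(u, v, k). k) (\<lambda>(u, v, k). u) \<le> s1"
      "cond_mutual_info (extend_law (map_pmf prod.swap ?\<mu>) K) (\<lambda>(u, v, k). u) (\<lambda>(u, v, k). k) (\<lambda>(u, v, k). v) \<le> s2"
      "cond_mutual_info (extend_law (map_pmf prod.swap ?\<mu>) K) (\<lambda>(u, v, k). u) (\<lambda>(u, v, k). v) (\<lambda>(u, v, k). k) \<le> c"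
    using s unfolding tension_def swap Let_def by blast
  define W where "W = joint_law ?\<mu> K (conversation P (out1 P) (out2 P))"
  have p: "p = map_pmf (\<lambda>\<omega>. (rvX \<omega>, rvY \<omega>, rvA \<omega>, rvB \<omega>)) W"
    using P(1) unfolding realizes_def run_protocol_eq_map_joint_law[of P ?\<mu> K] W_def[symmetric]
    by (simp add: map_pmf_comp)
  have ent_p: "ent p B Y = ent W rvB rvY" "ent p A X = ent W rvA rvX"
    "ent p (\<lambda>\<omega>. (A \<omega>, B \<omega>)) (\<lambda>\<omega>. (X \<omega>, Y \<omega>)) = ent W (\<lambda>\<omega>. (rvA \<omega>, rvB \<omega>)) (\<lambda>\<omega>. (rvX \<omega>, rvY \<omega>))"
    unfolding p ent_map X_def Y_def A_def B_def by simp_all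
  have fin_W: "fin_ent W rvA" "fin_ent W rvB"
    using fin unfolding p fin_ent_map X_def Y_def A_def B_def by simp_all
  note fin_W = fin_W fin_ent_finite[of W rvX] fin_ent_finite[of W rvY]
  have s': "ent W rvX rvY - ent W rvX (\<lambda>\<omega>. (rvQ \<omega>, rvY \<omega>)) \<le> s1"
    "ent W rvY rvX - ent W rvY (\<lambda>\<omega>. (rvQ \<omega>, rvX \<omega>)) \<le> s2"
    "ent W rvY rvQ - ent W rvY (\<lambda>\<omega>. (rvX \<omega>, rvQ \<omega>)) \<le> c"
    using K unfolding extend_law_eq_map_joint_law[of ?\<mu> K "conversation P (out1 P) (out2 P)"] W_def[symmetric]
    by (simp_all add: cond_mutual_info_map fin_W)
  have r': "ent W rvX rvY - ent W rvX (\<lambda>\<omega>. (rvM \<omega>, rvY \<omega>)) \<le> r1"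
    "ent W rvY rvX - ent W rvY (\<lambda>\<omega>. (rvM \<omega>, rvX \<omega>)) \<le> r2"
    using P(2,3) unfolding IC12_def IC21_def run_protocol_eq_map_joint_law[of P ?\<mu> K] W_def[symmetric]
    by (simp_all add: cond_mutual_info_map fin_W)
  note ci = cond_indep_Q_M[of ?\<mu> K P "out1 P" "out2 P", folded W_def]
    cond_indep_X_B[of ?\<mu> K P "out1 P" "out2 P", folded W_def]
    cond_indep_Y_A[of ?\<mu> K P "out1 P" "out2 P", folded W_def]
    cond_indep_A_BY[of ?\<mu> K P "out1 P" "out2 P", folded W_def]
  \<comment> \<open>The second rate uses the leakage bound with the parties exchanged, which
    conditions on the inputs in the opposite order.\<close>
  have ci_swap: "cond_indep W rvQ rvM (\<lambda>\<omega>. (rvY \<omega>, rvX \<omega>))"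
  proof -
    have "level_prob W (\<lambda>\<omega>. (rvQ \<omega>, rvM \<omega>, rvY \<omega>, rvX \<omega>)) = level_prob W (\<lambda>\<omega>. (rvQ \<omega>, rvM \<omega>, rvX \<omega>, rvY \<omega>))"
      "level_prob W (\<lambda>\<omega>. (rvQ \<omega>, rvY \<omega>, rvX \<omega>)) = level_prob W (\<lambda>\<omega>. (rvQ \<omega>, rvX \<omega>, rvY \<omega>))"
      "level_prob W (\<lambda>\<omega>. (rvM \<omega>, rvY \<omega>, rvX \<omega>)) = level_prob W (\<lambda>\<omega>. (rvM \<omega>, rvX \<omega>, rvY \<omega>))"
      "level_prob W (\<lambda>\<omega>. (rvY \<omega>, rvX \<omega>)) = level_prob W (\<lambda>\<omega>. (rvX \<omega>, rvY \<omega>))"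
      by (auto intro!: ext level_prob_cong)
    then show ?thesis using ci(1) by (simp add: cond_indep_def)
  qed

  \<comment> \<open>The alphabet of a channel in \<open>tension\<close> is \<open>nat\<close>, so
    \<open>(Q, M)\<close> is encoded by \<open>to_nat\<close>; injectivity keeps all conditional
    entropies.\<close>
  define \<phi> where "\<phi> \<omega> = ((rvB \<omega>, rvY \<omega>), (rvA \<omega>, rvX \<omega>), to_nat (rvQ \<omega>, rvM \<omega>))"
    for \<omega> :: "('x \<times> 'y) \<times> nat \<times> bool list list \<times> 'a \<times> 'b"
  obtain K' where K': "extend_law (map_pmf (\<lambda>(u, v, k). (u, v)) (map_pmf \<phi> W)) K' = map_pmf \<phi> W"
    by (rule extend_law_disintegration)
  have "map_pmf (\<lambda>(u, v, k). (u, v)) (map_pmf \<phi> W) = map_pmf (\<lambda>(x, y, a, b). ((b, y), (a, x))) p"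
    unfolding p by (simp add: map_pmf_comp \<phi>_def)
  note law = K'[unfolded this]
  let ?U = "\<lambda>\<omega>. (rvB \<omega>, rvY \<omega>)" and ?V = "\<lambda>\<omega>. (rvA \<omega>, rvX \<omega>)" and ?QM = "\<lambda>\<omega>. (rvQ \<omega>, rvM \<omega>)"
  have fin_UV: "fin_ent W ?U" "fin_ent W ?V"
    by (intro fin_ent_pair fin_W)+
  have 1: "cond_mutual_info (map_pmf \<phi> W) (\<lambda>(u, v, k). v) (\<lambda>(u, v, k). k) (\<lambda>(u, v, k). u)
      = ent W ?V ?U - ent W ?V (\<lambda>\<omega>. (?QM \<omega>, ?U \<omega>))"
    by (subst cond_mutual_info_map) (auto simp: \<phi>_def fin_UV intro!: ent_cong)
  have 2: "cond_mutual_info (map_pmf \<phi> W) (\<lambda>(u, v, k). u) (\<lambda>(u, v, k). k) (\<lambda>(u, v, k). v)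
      = ent W ?U ?V - ent W ?U (\<lambda>\<omega>. (?QM \<omega>, ?V \<omega>))"
    by (subst cond_mutual_info_map) (auto simp: \<phi>_def fin_UV intro!: ent_cong)
  have 3: "cond_mutual_info (map_pmf \<phi> W) (\<lambda>(u, v, k). u) (\<lambda>(u, v, k). v) (\<lambda>(u, v, k). k)
      = ent W ?U ?QM - ent W ?U (\<lambda>\<omega>. (?V \<omega>, ?QM \<omega>))"
    by (subst cond_mutual_info_map) (auto simp: \<phi>_def fin_UV intro!: ent_cong arg_cong2[where f = "(-)"])
  have swap_AB: "ent W (\<lambda>\<omega>. (rvB \<omega>, rvA \<omega>)) (\<lambda>\<omega>. (rvY \<omega>, rvX \<omega>)) = ent W (\<lambda>\<omega>. (rvA \<omega>, rvB \<omega>)) (\<lambda>\<omega>. (rvX \<omega>, rvY \<omega>))"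
    by (rule ent_cong) auto
  have le1: "ent W ?V ?U - ent W ?V (\<lambda>\<omega>. (?QM \<omega>, ?U \<omega>)) \<le> s1 + (r1 - (ent p B Y - ent p (\<lambda>\<omega>. (A \<omega>, B \<omega>)) (\<lambda>\<omega>. (X \<omega>, Y \<omega>))))"
    using leakage_bound[OF fin_W(3,1,2) ci(1,2)] s' r' unfolding ent_p by linarith
  have le2: "ent W ?U ?V - ent W ?U (\<lambda>\<omega>. (?QM \<omega>, ?V \<omega>)) \<le> s2 + (r2 - (ent p A X - ent p (\<lambda>\<omega>. (A \<omega>, B \<omega>)) (\<lambda>\<omega>. (X \<omega>, Y \<omega>))))"
    using leakage_bound[OF fin_W(4,2,1) ci_swap ci(3)] s' r' unfolding ent_p swap_AB by linarith
  have le3: "ent W ?U ?QM - ent W ?U (\<lambda>\<omega>. (?V \<omega>, ?QM \<omega>)) \<le> c"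
    using mutual_info_outputs[OF fin_W(4,2) ci(4,2)] s'(3)
      mutual_info_transcript_le[of ?\<mu> K P "out1 P" "out2 P", folded W_def] by linarith
  \<comment> \<open>The definition of \<open>tension\<close> also requires nonnegative coordinates;
    they follow because both coordinates dominate a nonnegative information quantity.\<close>
  have nonneg: "ent W ?V (\<lambda>\<omega>. (?QM \<omega>, ?U \<omega>)) \<le> ent W ?V ?U" "ent W ?U (\<lambda>\<omega>. (?QM \<omega>, ?V \<omega>)) \<le> ent W ?U ?V"
    by (intro ent_conditioning_le fin_UV)+
  show ?thesis
    unfolding tension_def Let_def
    using le1 le2 le3 nonneg by (auto simp: law 1 2 3 intro!: exI[of _ K'])
qed

text \<open>A constant \<open>Q\<close> leaks nothing in either direction; the level
  \<open>c\<close> is then the information between the two coordinates. The point serves to show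
  that the shifted rates are nonnegative.\<close>

lemma zero_in_tension:
  fixes q :: "('u::finite \<times> 'v::finite) pmf"
  shows "\<exists>c. (0, 0) \<in> tension c q"
proof -
  let ?p = "extend_law q (\<lambda>_ _. return_pmf 0)"
  define c where "c = cond_mutual_info ?p (\<lambda>(u, v, k). u) (\<lambda>(u, v, k). v) (\<lambda>(u, v, k). k)"
  have p: "?p = map_pmf (\<lambda>(u, v). (u, v, 0)) q"
    by (simp add: extend_law_def map_pmf_def bind_return_pmf split_beta')
  have "cond_mutual_info ?p (\<lambda>(u, v, k). v) (\<lambda>(u, v, k). k) (\<lambda>(u, v, k). u) = 0"
    "cond_mutual_info ?p (\<lambda>(u, v, k). u) (\<lambda>(u, v, k). k) (\<lambda>(u, v, k). v) = 0"
    unfolding p by (subst cond_mutual_info_map, rule fin_ent_finite, auto intro!: ent_cong)+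
  then have "(0, 0) \<in> tension c q"
    unfolding tension_def Let_def by (auto simp: c_def intro!: exI[of _ "\<lambda>_ _. return_pmf 0"])
  then show ?thesis ..
qed

section \<open>Upward closure of the regions\<close>

lemma tension_upward:
  "(r1, r2) \<in> tension c q \<Longrightarrow> r1 \<le> r1' \<Longrightarrow> r2 \<le> r2' \<Longrightarrow> (r1', r2') \<in> tension c q"
  unfolding tension_def Let_def by (auto intro: order_trans)

lemma outer_region_upward:
  assumes "(a, b) \<in> outer_region p" "0 \<le> d" "0 \<le> e"
  shows "(d + a, e + b) \<in> outer_region p"
  unfolding outer_region_def region_diff_def
proof (clarsimp, intro conjI ballI subsetI)
  have ab: "0 \<le> a" "0 \<le> b"
    using assms(1) by (auto simp: outer_region_def region_diff_def)
  then show "0 \<le> d + a" "0 \<le> e + b" for c :: real using assms by auto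
  fix c :: real and z assume c: "0 \<le> c"
    and z: "z \<in> (d + a, e + b) +o tension c (map_pmf (\<lambda>(x, y, a, b). (y, x)) p)"
  then obtain s1 s2 where s: "(s1, s2) \<in> tension c (map_pmf (\<lambda>(x, y, a, b). (y, x)) p)"
    "z = (d + a + s1, e + b + s2)"
    by (auto simp: elt_set_plus_def)
  have "(a + s1, b + s2) \<in> tension c (map_pmf (\<lambda>(x, y, a, b). ((b, y), (a, x))) p)"
    using assms(1) c s(1) by (force simp: outer_region_def region_diff_def elt_set_plus_def)
  then show "z \<in> tension c (map_pmf (\<lambda>(x, y, a, b). ((b, y), (a, x))) p)"
    unfolding s(2) by (rule tension_upward) (use assms in auto)
qed

theorem theorem1:
  fixes p :: "('x::finite \<times> 'y::finite \<times> 'a::countable \<times> 'b::countable) pmf"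
    and X :: "'x \<times> 'y \<times> 'a \<times> 'b \<Rightarrow> 'x" and Y :: "'x \<times> 'y \<times> 'a \<times> 'b \<Rightarrow> 'y"
    and A :: "'x \<times> 'y \<times> 'a \<times> 'b \<Rightarrow> 'a" and B :: "'x \<times> 'y \<times> 'a \<times> 'b \<Rightarrow> 'b"
    and hAX hBY hABXY :: real
  defines "X \<equiv> \<lambda>(x, y, a, b). x" and "Y \<equiv> \<lambda>(x, y, a, b). y"
    and "A \<equiv> \<lambda>(x, y, a, b). a" and "B \<equiv> \<lambda>(x, y, a, b). b"
  defines "hAX \<equiv> cond_entropy p A X"
    and "hBY \<equiv> cond_entropy p B Y"
    and "hABXY \<equiv> cond_entropy p (\<lambda>\<omega>. (A \<omega>, B \<omega>)) (\<lambda>\<omega>. (X \<omega>, Y \<omega>))"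
  assumes "has_finite_entropy p A" and "has_finite_entropy p B"
  shows "info_complexity_region p \<subseteq> (hBY - hABXY, hAX - hABXY) +o outer_region p
    \<and> (hAX \<ge> hABXY \<and> hBY \<ge> hABXY \<longrightarrow> info_complexity_region p \<subseteq> outer_region p)"
proof -
  let ?d1 = "hBY - hABXY" and ?d2 = "hAX - hABXY"
  have region: "(r1 - ?d1, r2 - ?d2) \<in> outer_region p" if r: "(r1, r2) \<in> info_complexity_region p" for r1 r2
  proof -
    obtain P :: "('x, 'y, 'a, 'b) protocol"
      where P: "realizes P p" "IC12 P (input_law p) \<le> r1" "IC21 P (input_law p) \<le> r2"
      using r by (auto simp: info_complexity_region_def)
    have shift: "(s1 + (r1 - ?d1), s2 + (r2 - ?d2)) \<in> tension c (map_pmf (\<lambda>(x, y, a, b). ((b, y), (a, x))) p)"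
      if "(s1, s2) \<in> tension c (map_pmf (\<lambda>(x, y, a, b). (y, x)) p)" for s1 s2 c
      using tension_shift[OF assms(8,9)[unfolded A_def B_def, THEN has_finite_entropy_imp_fin_ent] P that]
      by (simp add: hAX_def hBY_def hABXY_def cond_entropy_eq_ent X_def Y_def A_def B_def)
    \<comment> \<open>Shifting the origin must give a point of a tension region, and such points
      have nonnegative coordinates.\<close>
    obtain c where "(0, 0) \<in> tension c (map_pmf (\<lambda>(x, y, a, b). (y, x)) p)"
      using zero_in_tension by blast
    then have "0 \<le> r1 - ?d1" "0 \<le> r2 - ?d2"
      using shift[of 0 0 c] by (auto simp: tension_def)
    then show ?thesis
      using shift by (auto simp: outer_region_def region_diff_def elt_set_plus_def add.commute)
  qed
  have "info_complexity_region p \<subseteq> (?d1, ?d2) +o outer_region p"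
  proof
    fix r assume "r \<in> info_complexity_region p"
    then show "r \<in> (?d1, ?d2) +o outer_region p"
      using region[of "fst r" "snd r"]
      by (auto simp: elt_set_plus_def prod_eq_iff intro!: bexI[of _ "(fst r - ?d1, snd r - ?d2)"])
  qed
  moreover have "info_complexity_region p \<subseteq> outer_region p" if "hAX \<ge> hABXY" "hBY \<ge> hABXY"
  proof
    fix r assume "r \<in> info_complexity_region p"
    then show "r \<in> outer_region p"
      \<comment> \<open>\<open>r\<close> is the shifted pair plus \<open>(?d1, ?d2)\<close>, which
        is now nonnegative, so upward closure absorbs the shift.\<close>
      using outer_region_upward[OF region[of "fst r" "snd r"], of ?d1 ?d2] that by simp
  qed
  ultimately show ?thesis by blast
qed

end
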